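(* Let $\alpha\in(0,1)$ and assume that the following conditions hold: (A1) For every $t\in\mathbb{R}^s$ there exists $y\ge 0$ with $Wy=t$. (A2) There exists $v\in\mathbb{R}^s$ with $W^\top v<q$ componentwise. (A3) $\int_{\mathbb{R}^s}\|z\|\,\mu(\mathrm{d}z)<\infty$. (A4) $\mu$ has a density $\theta$ with respect to Lebesgue measure, and there exist a convex open set $V\subset\mathbb{R}^s$ and constants $r,\rho>0$ such that $\theta\ge r$ almost surely on $V+B_\rho(0)$. (A5) $\eta_0>0$ is such that $\|\hat y^i(\eta_0)\|<\rho$ for all $i\in I^+$, with $\rho$ from (A4). (A6) $q>0$ componentwise. Assume moreover that $$\sup_{x\in V}Q_{\alpha VaR}(x)\le\eta_0 .$$ Then $Q_{\alpha CVaR}$ is $\frac{\kappa}{\alpha}$-strongly convex on $V$, where $\kappa>0$ is the modulus of partial strong convexity of $Q_{EE}$ with respect to $x$ for $\eta\le\eta_0$. That is: there exists $\kappa>0$ such that $Q_{EE}$ is partially $\kappa$-strongly convex with respect to $x$ on $V\times(-\infty,\eta_0]$, and for any such $\kappa$ the function $Q_{\alpha CVaR}$ is $\frac{\kappa}{\alpha}$-strongly convex on $V$.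
   Context: $W\in\mathbb{R}^{s\times m}$ and $q\in\mathbb{R}^m$ are fixed, $\mu$ is a Borel probability measure on $\mathbb{R}^s$, and $\varphi(t)=\min\{q^\top y \mid Wy=t,\ y\ge 0\}$ for $t\in\mathbb{R}^s$. Define, for $x\in\mathbb{R}^s$ and $\eta\in\mathbb{R}$, $$Q_{EE}(x,\eta)=\int_{\mathbb{R}^s}\max\{0,\varphi(z-x)-\eta\}\,\mu(\mathrm{d}z),\qquad Q_{\alpha CVaR}(x)=\min_{\eta\in\mathbb{R}}\Big\{\eta+\frac1\alpha Q_{EE}(x,\eta)\Big\},$$ $$Q_{\alpha VaR}(x)=\inf\{t\in\mathbb{R}\mid \mu(\{z\mid\varphi(z-x)\le t\})\ge 1-\alpha\}.$$ $B_\rho(0)$ is the ball of radius $\rho$ around $0$. A real function $f$ on a convex set $V$ is $\kappa$-strongly convex if $f(\lambda x+(1-\lambda)y)\le\lambda f(x)+(1-\lambda)f(y)-\frac{\kappa}{2}\lambda(1-\lambda)\|x-y\|^2$ for all $x,y\in V$, $\lambda\in(0,1)$. A function $f$ on $V\times U$ (with $V,U$ convex) is partially $\kappa$-strongly convex with respect to its first argument if $f(\lambda(x_1,y_1)+(1-\lambda)(x_2,y_2))\le\lambda f(x_1,y_1)+(1-\lambda)f(x_2,y_2)-\frac{\kappa}{2}\lambda(1-\lambda)\|x_1-x_2\|^2$ for all $x_1,x_2\in V$, $y_1,y_2\in U$, $\lambda\in(0,1)$. Under (A1) and (A2), $\{v\mid W^\top v\le q\}$ is the convex hull of its finitely many extreme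 points $d_i$, $i\in I=\{1,\dots,N\}$, and $\varphi(t)=\max_{i\in I}d_i^\top t$. Put $K_i=\{z\mid (d_i-d_j)^\top z\ge 0\ \text{for all } j\in I\}$; these are $s$-dimensional pointed polyhedral cones covering $\mathbb{R}^s$. Write $K_i=\mathrm{cone}\{t^i_1,\dots,t^i_{n_i}\}$ where $\{rt^i_k\mid r\ge 0\}$, $k=1,\dots,n_i$, are the extreme rays of $K_i$. Let $K_i^+=K_i\cap\{z\mid d_i^\top z\ge 0\}$ and $I^+=\{i\in I\mid \mathrm{int}\,K_i^+\ne\emptyset,\ d_i\ne 0\}$. For $\eta_0>0$ and $i\in I^+$ the hyperplane $\{z\mid d_i^\top z=\eta_0\}$ intersects at least one extreme ray of $K_i$ in a single point; $\hat y^i(\eta_0)$ denotes such an intersection point (over all extreme rays of $K_i$) of minimum norm. *)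

theory Defs
  imports "HOL-Probability.Probability"
begin

text \<open>
  Vector inequalities are written out componentwise: the library's strict order on
  \<open>real ^ 'm\<close> is not the componentwise strict inequality.
\<close>

text \<open>
  Under complete recourse and dual feasibility the minimum is attained at every \<open>t\<close>,
  so that \<open>Inf\<close> is the minimum.
\<close>

definition recourse_value :: "real ^ 'm ^ 's \<Rightarrow> real ^ 'm \<Rightarrow> real ^ 's \<Rightarrow> real" where
  "recourse_value W q t = Inf {q \<bullet> y | y. W *v y = t \<and> (\<forall>j. 0 \<le> y $ j)}"

definition Q_EE ::
    "real ^ 'm ^ 's \<Rightarrow> real ^ 'm \<Rightarrow> (real ^ 's) measure \<Rightarrow> real ^ 's \<Rightarrow> real \<Rightarrow> real" where
  "Q_EE W q \<mu> x \<eta> = (\<integral>z. max 0 (recourse_value W q (z - x) - \<eta>) \<partial>\<mu>)"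

text \<open>
  If moreover \<open>\<mu>\<close> is a probability measure with finite first moment and \<open>0 < \<alpha> < 1\<close>,
  the following infimum over \<open>\<eta>\<close> is attained as well.
\<close>

definition Q_CVaR ::
    "real ^ 'm ^ 's \<Rightarrow> real ^ 'm \<Rightarrow> (real ^ 's) measure \<Rightarrow> real \<Rightarrow> real ^ 's \<Rightarrow> real" where
  "Q_CVaR W q \<mu> \<alpha> x = (INF \<eta>. \<eta> + 1 / \<alpha> * Q_EE W q \<mu> x \<eta>)"

definition Q_VaR ::
    "real ^ 'm ^ 's \<Rightarrow> real ^ 'm \<Rightarrow> (real ^ 's) measure \<Rightarrow> real \<Rightarrow> real ^ 's \<Rightarrow> real" where
  "Q_VaR W q \<mu> \<alpha> x = Inf {t. measure \<mu> {z. recourse_value W q (z - x) \<le> t} \<ge> 1 - \<alpha>}"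

definition strongly_convex_on :: "real \<Rightarrow> 'a::real_normed_vector set \<Rightarrow> ('a \<Rightarrow> real) \<Rightarrow> bool" where
  "strongly_convex_on \<kappa> V f \<longleftrightarrow> convex V \<and>
    (\<forall>x\<in>V. \<forall>y\<in>V. \<forall>u\<in>{0<..<1}.
      f (u *\<^sub>R x + (1 - u) *\<^sub>R y)
        \<le> u * f x + (1 - u) * f y - \<kappa> / 2 * u * (1 - u) * (norm (x - y))\<^sup>2)"

definition partially_strongly_convex_on ::
    "real \<Rightarrow> 'a::real_normed_vector set \<Rightarrow> 'b::real_vector set \<Rightarrow> ('a \<Rightarrow> 'b \<Rightarrow> real) \<Rightarrow> bool" where
  "partially_strongly_convex_on \<kappa> V U f \<longleftrightarrow> convex V \<and> convex U \<and>
    (\<forall>x1\<in>V. \<forall>x2\<in>V. \<forall>y1\<in>U. \<forall>y2\<in>U. \<forall>u\<in>{0<..<1}.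
      f (u *\<^sub>R x1 + (1 - u) *\<^sub>R x2) (u *\<^sub>R y1 + (1 - u) *\<^sub>R y2)
        \<le> u * f x1 y1 + (1 - u) * f x2 y2
          - \<kappa> / 2 * u * (1 - u) * (norm (x1 - x2))\<^sup>2)"

text \<open>
  The vertices \<open>d\<^sub>1, \<dots>, d\<^sub>N\<close> of the dual feasible set are not enumerated: the set of
  vertices serves as the index set, and cones, rays and intersection points are indexed
  by the vertex \<open>d\<close> itself.
\<close>

definition dual_feasible_set :: "real ^ 'm ^ 's \<Rightarrow> real ^ 'm \<Rightarrow> (real ^ 's) set" where
  "dual_feasible_set W q = {v. \<forall>j. (transpose W *v v) $ j \<le> q $ j}"

definition dual_vertices :: "real ^ 'm ^ 's \<Rightarrow> real ^ 'm \<Rightarrow> (real ^ 's) set" where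
  "dual_vertices W q = {d. d extreme_point_of dual_feasible_set W q}"

definition vertex_cone :: "real ^ 'm ^ 's \<Rightarrow> real ^ 'm \<Rightarrow> real ^ 's \<Rightarrow> (real ^ 's) set" where
  "vertex_cone W q d = {z. \<forall>d'\<in>dual_vertices W q. (d - d') \<bullet> z \<ge> 0}"

definition vertex_cone_plus :: "real ^ 'm ^ 's \<Rightarrow> real ^ 'm \<Rightarrow> real ^ 's \<Rightarrow> (real ^ 's) set" where
  "vertex_cone_plus W q d = vertex_cone W q d \<inter> {z. d \<bullet> z \<ge> 0}"

definition plus_vertices :: "real ^ 'm ^ 's \<Rightarrow> real ^ 'm \<Rightarrow> (real ^ 's) set" where
  "plus_vertices W q = {d \<in> dual_vertices W q. interior (vertex_cone_plus W q d) \<noteq> {} \<and> d \<noteq> 0}"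

definition extreme_ray_of :: "'a::real_vector set \<Rightarrow> 'a set \<Rightarrow> bool" where
  "extreme_ray_of R K \<longleftrightarrow> (\<exists>t. t \<noteq> 0 \<and> R = {r *\<^sub>R t | r. r \<ge> 0}) \<and> R face_of K"

definition ray_hyperplane_points ::
    "real ^ 'm ^ 's \<Rightarrow> real ^ 'm \<Rightarrow> real ^ 's \<Rightarrow> real \<Rightarrow> (real ^ 's) set" where
  "ray_hyperplane_points W q d \<eta> =
    {y. \<exists>R. extreme_ray_of R (vertex_cone W q d) \<and> R \<inter> {z. d \<bullet> z = \<eta>} = {y}}"

text \<open>
  A point of minimum norm need not be unique; \<^const>\<open>arg_min\<close> selects one of them. Its norm
  does not depend on the choice.
\<close>

definition min_norm_ray_point ::
    "real ^ 'm ^ 's \<Rightarrow> real ^ 'm \<Rightarrow> real ^ 's \<Rightarrow> real \<Rightarrow> real ^ 's" where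
  "min_norm_ray_point W q d \<eta> = arg_min norm (\<lambda>y. y \<in> ray_hyperplane_points W q d \<eta>)"

end

theory Submission
  imports Defs
begin

text \<open>
  Write \<open>\<phi>\<close> for the recourse value. It is the support function of the dual feasible polytope,
  and because \<open>q\<close> is positive this polytope contains \<open>0\<close> in its interior; hence
  \<open>c * norm t \<le> \<phi> t \<le> L * norm t\<close> with \<open>0 < c\<close>.

  Strong convexity is a local property: along a segment of pairs \<open>(x, \<eta>)\<close> it is enough that the second
  difference with step \<open>e\<close> is at least \<open>\<kappa> * e\<^sup>2\<close> for all small \<open>e\<close>, where only \<open>\<kappa>\<close> has to be uniform
  (\<open>strongly_convex_if_second_diff_ge\<close>). With \<open>t = z - x\<close>, a second difference of \<open>Q_EE\<close> is the
  \<open>\<mu>\<close>-integral of a second difference of \<open>max 0 (\<phi> t - \<eta>)\<close>. The integrand is nonnegative by convexity,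
  and for \<open>x \<in> V\<close> the density is at least \<open>r\<close> almost everywhere on \<open>norm t < \<rho>\<close>. So the first claim reduces to
  a lower bound for a Lebesgue integral over \<open>ball 0 \<rho>\<close>, uniform in \<open>\<eta> \<le> \<eta>\<^sub>0\<close> and quadratic in the
  \<open>x\<close>-component of the direction (\<open>uniform_curvature\<close>).

  The curvature of a piecewise linear function sits on its kinks, but no surface measure is required.
  A second difference with step \<open>N v\<close> telescopes into translates of second differences with step \<open>v\<close>,
  so the integral of the fine ones is at least \<open>1 / N\<^sup>2\<close> times that of the coarse ones
  (\<open>second_diff_coarse_le_fine\<close>), and a coarse second difference can be estimated pointwise. For a direction
  \<open>(h, \<delta>)\<close> there are two sources of curvature.

  \<^item> The level set \<open>\<phi> = \<eta>\<close>. In the interior of the cone of a vertex \<open>d\<close> the excess is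
    \<open>max 0 (d \<bullet> t - \<eta>)\<close>, which contributes a multiple of \<open>(d \<bullet> h - \<delta>)\<^sup>2\<close>. If \<open>d\<close> and \<open>d'\<close> attain \<open>\<phi>\<close> at
    \<open>h\<close> and at \<open>- h\<close>, then \<open>d \<bullet> h\<close> and \<open>d' \<bullet> h\<close> are at least \<open>2 * c * norm h\<close> apart, so one of the two
    squares is at least \<open>c\<^sup>2 * (norm h)\<^sup>2\<close> whatever \<open>\<delta>\<close> is. The assumption on the intersection points with
    extreme rays guarantees that the level set \<open>\<phi> = \<eta>\<^sub>0\<close> passes through the interior of each relevant cone
    inside \<open>ball 0 \<rho>\<close>; scaling gives the same for \<open>0 < \<eta> \<le> \<eta>\<^sub>0\<close>, with a constant that decays like
    \<open>(\<eta> / \<eta>\<^sub>0) ^ (s - 1)\<close>.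

  \<^item> The kink of \<open>\<phi>\<close> itself. Where \<open>\<phi>\<close> exceeds the level, the excess is affine in the level and \<open>\<delta>\<close> drops
    out. In dimension at least two there are lines parallel to \<open>h\<close> that stay away from the small set
    \<open>\<phi> \<le> 2 * \<eta>\<^sub>1\<close>, and coercivity makes \<open>\<phi>\<close> bend along them. This covers all levels below some \<open>\<eta>\<^sub>1 > 0\<close>,
    where the first bound degenerates. In dimension one the first bound does not degenerate, and only the levels
    \<open>\<eta> \<le> 0\<close> remain.

  For the second claim, \<open>\<eta> + 1 / \<alpha> * Q_EE x \<eta>\<close> is nondecreasing in \<open>\<eta>\<close> beyond the value at risk, since there
  \<open>Q_EE\<close> falls with slope at most \<open>\<alpha>\<close>. The infimum over \<open>\<eta>\<close> may therefore be restricted to \<open>\<eta> \<le> \<eta>\<^sub>0\<close>, and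
  partial strong convexity in \<open>x\<close> survives minimisation over the other argument.
\<close>

section \<open>Second differences of convex functions\<close>

definition second_diff :: "('a::real_vector \<Rightarrow> real) \<Rightarrow> 'a \<Rightarrow> 'a \<Rightarrow> real" where
  "second_diff G v t = G (t + v) + G (t - v) - 2 * G t"

lemma second_diff_nonneg:
  assumes "convex_on UNIV G"
  shows "0 \<le> second_diff G v t"
proof -
  have "G ((1/2) *\<^sub>R (t + v) + (1/2) *\<^sub>R (t - v)) \<le> (1/2) * G (t + v) + (1/2) * G (t - v)"
    using convex_onD[OF assms, of "1/2" "t + v" "t - v"] by simp
  moreover have "(1/2) *\<^sub>R (t + v) + (1/2) *\<^sub>R (t - v) = t"
    by (simp add: scaleR_right_distrib scaleR_right_diff_distrib flip: scaleR_left_distrib)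
  ultimately show ?thesis by (simp add: second_diff_def)
qed

text \<open>
  With \<open>g\<close> the restriction of \<open>G\<close> to the line through \<open>t\<close> in direction \<open>v\<close>, the left side is the difference of
  the increments of \<open>g\<close> over the two outermost unit steps, and the right side sums the changes between
  neighbouring increments.
\<close>

lemma second_diff_telescope:
  "second_diff G (real (Suc M) *\<^sub>R v) t - second_diff G (real M *\<^sub>R v) t
    = second_diff G v t + (\<Sum>k=1..M. second_diff G v (t + real k *\<^sub>R v) + second_diff G v (t - real k *\<^sub>R v))"
proof -
  define g where "g = (\<lambda>x. G (t + x *\<^sub>R v))"
  have plus: "second_diff G v (t + x *\<^sub>R v) = g (x + 1) + g (x - 1) - 2 * g x" for x
    by (simp add: second_diff_def g_def algebra_simps)
  have minus: "second_diff G v (t - x *\<^sub>R v) = g (- x + 1) + g (- x - 1) - 2 * g (- x)" for x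
    using plus[of "- x"] by simp
  have zero: "second_diff G v t = g 1 + g (- 1) - 2 * g 0"
    using plus[of 0] by simp
  have multiple: "second_diff G (x *\<^sub>R v) t = g x + g (- x) - 2 * g 0" for x
    by (simp add: second_diff_def g_def)
  show ?thesis
    unfolding plus minus zero multiple
    by (induction M) (simp_all add: add.commute)
qed

lemma set_integrable_continuous_bounded:
  fixes G :: "'a::euclidean_space \<Rightarrow> real"
  assumes "continuous_on UNIV G" "bounded B" "B \<in> sets borel"
  shows "set_integrable lborel B G"
proof -
  have "set_integrable lborel (closure B) G"
    unfolding set_integrable_def
    using assms by (intro borel_integrable_compact) (auto intro: continuous_on_subset)
  then show ?thesis
    by (rule set_integrable_subset) (use assms closure_subset in auto)
qed

lemma continuous_on_second_diff:
  fixes G :: "'a::euclidean_space \<Rightarrow> real"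
  assumes "continuous_on UNIV G"
  shows "continuous_on UNIV (\<lambda>t. second_diff G v (t + w))"
  unfolding second_diff_def
  by (intro continuous_intros continuous_on_compose2[OF assms]) auto

lemma translate_in_borel:
  fixes A :: "'a::euclidean_space set"
  assumes "A \<in> sets borel"
  shows "(+) w ` A \<in> sets borel"
proof -
  have "(+) w ` A = (\<lambda>t. t - w) -` A \<inter> space borel"
    by (force simp: image_iff)
  also have "\<dots> \<in> sets borel"
    using assms by (intro measurable_sets[where A = borel]) auto
  finally show ?thesis .
qed

lemma set_integral_translate:
  fixes f :: "'a::euclidean_space \<Rightarrow> real"
  assumes [measurable]: "f \<in> borel_measurable borel" "A \<in> sets borel"
  shows "(LINT t:A|lborel. f (t + w)) = (LINT t:(+) w ` A|lborel. f t)"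
proof -
  note [measurable] = translate_in_borel[OF assms(2), of w]
  have "(LINT t:(+) w ` A|lborel. f t)
    = (LINT t|distr lborel borel ((+) w). indicator ((+) w ` A) t *\<^sub>R f t)"
    by (simp add: lborel_distr_plus set_lebesgue_integral_def)
  also have "\<dots> = (LINT t|lborel. indicator ((+) w ` A) (w + t) *\<^sub>R f (w + t))"
    by (subst integral_distr) auto
  also have "\<dots> = (LINT t:A|lborel. f (t + w))"
    unfolding set_lebesgue_integral_def
    by (intro Bochner_Integration.integral_cong) (auto simp: indicator_def add.commute)
  finally show ?thesis by simp
qed

lemma set_integral_mono_set_nonneg:
  fixes f :: "'a \<Rightarrow> real"
  assumes "set_integrable M B f" "A \<in> sets M" "A \<subseteq> B" "\<And>t. t \<in> B \<Longrightarrow> 0 \<le> f t"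
  shows "(LINT t:A|M. f t) \<le> (LINT t:B|M. f t)"
  using assms(1) set_integrable_subset[OF assms(1-3)] assms(3,4)
  unfolding set_lebesgue_integral_def set_integrable_def
  by (intro integral_mono) (auto split: split_indicator)

text \<open>
  Passing from \<open>N\<close> to \<open>N + 1\<close> adds \<open>2 N + 1\<close> translates of the fine second difference, each of whose integrals
  over \<open>A\<close> is bounded by the integral over \<open>B\<close>; and \<open>1 + 3 + \<dots> + (2 N - 1) = N\<^sup>2\<close>.
\<close>

lemma second_diff_coarse_le_fine:
  fixes G :: "'a::euclidean_space \<Rightarrow> real"
  assumes G: "convex_on UNIV G"
    and A: "bounded A" "A \<in> sets borel" and B: "bounded B" "B \<in> sets borel"
    and sub: "\<And>t k. t \<in> A \<Longrightarrow> k < N \<Longrightarrow> t + real k *\<^sub>R v \<in> B \<and> t - real k *\<^sub>R v \<in> B"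
  shows "(LINT t:A|lborel. second_diff G (real N *\<^sub>R v) t)
    \<le> (real N)\<^sup>2 * (LINT t:B|lborel. second_diff G v t)"
  using sub
proof (induction N)
  case 0
  then show ?case by (simp add: second_diff_def)
next
  case (Suc N)
  let ?I = "LINT t:B|lborel. second_diff G v t"
  have cont: "continuous_on UNIV G"
    using convex_on_continuous[OF open_UNIV G] .
  note csd = continuous_on_second_diff[OF cont]
  have intA: "set_integrable lborel A (\<lambda>t. second_diff G u (t + w))" for u w
    by (intro set_integrable_continuous_bounded csd A)
  have intB: "set_integrable lborel B (\<lambda>t. second_diff G u t)" for u
    using set_integrable_continuous_bounded[OF csd[of u 0] B] by simp
  have transl: "(LINT t:A|lborel. second_diff G v (t + w)) \<le> ?I"
    if "\<And>t. t \<in> A \<Longrightarrow> t + w \<in> B" for w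
  proof -
    have "(LINT t:A|lborel. second_diff G v (t + w)) = (LINT t:(+) w ` A|lborel. second_diff G v t)"
      using csd[of v 0] A
      by (intro set_integral_translate) (auto intro: borel_measurable_continuous_onI)
    also have "\<dots> \<le> ?I"
      using that translate_in_borel[OF A(2), of w]
      by (intro set_integral_mono_set_nonneg intB second_diff_nonneg[OF G]) (auto simp: add.commute)
    finally show ?thesis .
  qed
  have "(LINT t:A|lborel. second_diff G (real (Suc N) *\<^sub>R v) t)
    - (LINT t:A|lborel. second_diff G (real N *\<^sub>R v) t)
    = (LINT t:A|lborel. second_diff G (real (Suc N) *\<^sub>R v) t - second_diff G (real N *\<^sub>R v) t)"
    using intA[of _ 0] by (subst set_integral_diff) auto
  also have "\<dots> = (LINT t:A|lborel. second_diff G v t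
      + (\<Sum>k=1..N. second_diff G v (t + real k *\<^sub>R v) + second_diff G v (t - real k *\<^sub>R v)))"
    unfolding second_diff_telescope ..
  also have "\<dots> = (LINT t:A|lborel. second_diff G v (t + 0))
      + (\<Sum>k=1..N. (LINT t:A|lborel. second_diff G v (t + real k *\<^sub>R v))
          + (LINT t:A|lborel. second_diff G v (t + - real k *\<^sub>R v)))"
    using intA[unfolded set_integrable_def]
      intA[of v "- real k *\<^sub>R v" for k, unfolded set_integrable_def, simplified]
      intA[of v 0, unfolded set_integrable_def, simplified]
    unfolding set_lebesgue_integral_def
    by (simp add: scaleR_sum_right scaleR_add_right distrib_left sum_distrib_left)
  also have "\<dots> \<le> ?I + (\<Sum>k=1..N. ?I + ?I)"
    using Suc.prems by (intro add_mono sum_mono transl) (force, force, force)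
  also have "\<dots> = (2 * real N + 1) * ?I"
    by (simp add: algebra_simps)
  finally have "(LINT t:A|lborel. second_diff G (real (Suc N) *\<^sub>R v) t)
     \<le> (real N)\<^sup>2 * ?I + (2 * real N + 1) * ?I"
    using Suc.IH Suc.prems by force
  then show ?case
    by (simp add: power2_eq_square algebra_simps)
qed

text \<open>
  Take the largest \<open>N\<close> with \<open>N * norm v \<le> T\<close>. Then \<open>N * norm v\<close> lies between \<open>T / 2\<close> and \<open>T\<close>, and
  \<open>1 / N\<^sup>2 \<ge> (norm v)\<^sup>2 / T\<^sup>2\<close>: a pointwise estimate at the fixed scale \<open>T\<close> becomes a bound of the right order
  \<open>(norm v)\<^sup>2\<close> at every small scale.
\<close>

lemma integral_second_diff_lower_bound:
  fixes G :: "'a::euclidean_space \<Rightarrow> real"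
  assumes G: "convex_on UNIV G" and v: "0 < norm v" "norm v \<le> T"
    and B: "bounded B" "B \<in> sets borel" and "0 \<le> m"
    and sub: "\<And>t s. t \<in> ball p R \<Longrightarrow> \<bar>s\<bar> \<le> T \<Longrightarrow> t + s *\<^sub>R sgn v \<in> B"
    and m: "\<And>t s. t \<in> ball p R \<Longrightarrow> T / 2 \<le> s \<Longrightarrow> s \<le> T \<Longrightarrow> m \<le> second_diff G (s *\<^sub>R sgn v) t"
  shows "(norm v)\<^sup>2 / T\<^sup>2 * (m * measure lborel (ball p R))
    \<le> (LINT t:B|lborel. second_diff G v t)"
proof -
  define N where "N = nat \<lfloor>T / norm v\<rfloor>"
  have T: "T > 0" using v by linarith
  have "1 \<le> T / norm v" using v by (simp add: field_simps)
  then have N1: "N \<ge> 1" by (simp add: N_def le_nat_iff le_floor_iff)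
  have NT: "real N * norm v \<le> T"
  proof -
    have "real N \<le> T / norm v" using v T by (simp add: N_def)
    then show ?thesis using v by (simp add: field_simps)
  qed
  have "T / norm v < real N + 1" using v T by (simp add: N_def)
  also have "\<dots> \<le> 2 * real N" using N1 by simp
  finally have NT2: "T / 2 \<le> real N * norm v" using v by (simp add: field_simps)
  have vs: "k *\<^sub>R v = (k * norm v) *\<^sub>R sgn v" for k
    using v by (simp add: sgn_div_norm)
  have sgn_N: "real k * norm v \<le> T" if "k < N" for k
    using that NT v by (smt (verit) mult_right_mono of_nat_less_iff)
  have cont: "continuous_on UNIV G"
    using convex_on_continuous[OF open_UNIV G] .
  have "m * measure lborel (ball p R) = (LINT t:ball p R|lborel. m)"
    by (subst set_integral_const) (use emeasure_lborel_ball_finite[of p R] in auto)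
  also have "\<dots> \<le> (LINT t:ball p R|lborel. second_diff G (real N *\<^sub>R v) t)"
  proof (rule set_integral_mono)
    show "set_integrable lborel (ball p R) (second_diff G (real N *\<^sub>R v))"
      using set_integrable_continuous_bounded[OF continuous_on_second_diff[OF cont, of _ 0]]
      by simp
    show "m \<le> second_diff G (real N *\<^sub>R v) t" if "t \<in> ball p R" for t
      unfolding vs using that NT NT2 by (intro m) auto
  qed (auto intro!: set_integrable_continuous_bounded)
  also have "\<dots> \<le> (real N)\<^sup>2 * (LINT t:B|lborel. second_diff G v t)"
  proof (rule second_diff_coarse_le_fine[OF G _ _ B])
    fix t k assume tk: "t \<in> ball p R" "k < N"
    show "t + real k *\<^sub>R v \<in> B \<and> t - real k *\<^sub>R v \<in> B"
      using sub[OF tk(1), of "real k * norm v"] sub[OF tk(1), of "- (real k * norm v)"] sgn_N[OF tk(2)]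
      unfolding vs by auto
  qed auto
  finally have 1: "m * measure lborel (ball p R) \<le> (real N)\<^sup>2 * (LINT t:B|lborel. second_diff G v t)" .
  have I0: "0 \<le> (LINT t:B|lborel. second_diff G v t)"
    unfolding set_lebesgue_integral_def
    using second_diff_nonneg[OF G] by (intro integral_nonneg_AE) auto
  have "(norm v)\<^sup>2 / T\<^sup>2 * (m * measure lborel (ball p R))
    \<le> (norm v)\<^sup>2 / T\<^sup>2 * ((real N)\<^sup>2 * (LINT t:B|lborel. second_diff G v t))"
    by (intro mult_left_mono 1) auto
  also have "\<dots> = (real N * norm v / T)\<^sup>2 * (LINT t:B|lborel. second_diff G v t)"
    by (simp add: power_mult_distrib power_divide)
  also have "\<dots> \<le> 1 * (LINT t:B|lborel. second_diff G v t)"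
  proof (intro mult_right_mono I0 power_le_one)
    show "real N * norm v / T \<le> 1" using NT T by simp
  qed (use T in simp)
  finally show ?thesis by simp
qed

text \<open>
  Add a parabola with a slightly smaller modulus to the difference of \<open>f\<close> and its chord. The resulting function vanishes at
  both ends and has positive second differences for small steps, so it has no positive interior maximum.
\<close>

lemma strongly_convex_if_second_diff_ge:
  fixes f :: "real \<Rightarrow> real"
  assumes cont: "continuous_on {0..1} f"
    and loc: "\<And>t. 0 < t \<Longrightarrow> t < 1 \<Longrightarrow> \<exists>e0>0. \<forall>e. 0 < e \<longrightarrow> e < e0 \<longrightarrow> k * e\<^sup>2 \<le> second_diff f e t"
    and u: "0 \<le> u" "u \<le> 1"
  shows "f u \<le> (1 - u) * f 0 + u * f 1 - k / 2 * u * (1 - u)"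
proof (rule field_le_epsilon)
  fix d :: real assume d: "0 < d"
  \<comment> \<open>Since \<open>u * (1 - u) \<le> 1 / 4\<close>, lowering the modulus by \<open>8 * d\<close> costs at most \<open>d\<close>.\<close>
  define k' where "k' = k - 8 * d"
  define F where "F = (\<lambda>t. f t - ((1 - t) * f 0 + t * f 1) + k' / 2 * t * (1 - t))"
  have "F t \<le> 0" if t: "t \<in> {0..1}" for t
  proof (rule ccontr)
    assume neg: "\<not> F t \<le> 0"
    have "continuous_on {0..1} F"
      unfolding F_def by (intro continuous_intros cont)
    then obtain x where x: "x \<in> {0..1}" "\<And>y. y \<in> {0..1} \<Longrightarrow> F y \<le> F x"
      using continuous_attains_sup[of "{0..1::real}" F] by auto
    have Fx: "F x > 0" using x(2)[OF t] neg by simp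
    have "x \<noteq> 0" "x \<noteq> 1" using Fx by (auto simp: F_def)
    with x have x01: "0 < x" "x < 1" by auto
    obtain e0 where e0: "e0 > 0" "\<And>e. 0 < e \<Longrightarrow> e < e0 \<Longrightarrow> k * e\<^sup>2 \<le> second_diff f e x"
      using loc[OF x01] by blast
    define e where "e = min (e0 / 2) (min x (1 - x))"
    have e: "0 < e" "e < e0" "x + e \<in> {0..1}" "x - e \<in> {0..1}"
      using x01 e0 by (auto simp: e_def min_def)
    have "second_diff F e x = second_diff f e x - k' * e\<^sup>2"
      by (simp add: second_diff_def F_def power2_eq_square field_simps)
    also have "\<dots> \<ge> (k - k') * e\<^sup>2"
      using e0(2)[OF e(1,2)] by (simp add: algebra_simps)
    finally have "second_diff F e x > 0"
      using d e(1) unfolding k'_def by (smt (verit) mult_pos_pos zero_less_power)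
    then show False
      using x(2)[OF e(3)] x(2)[OF e(4)] by (simp add: second_diff_def)
  qed
  then have "F u \<le> 0" using u by simp
  moreover have "8 * d / 2 * u * (1 - u) \<le> d"
  proof -
    have "u * (1 - u) \<le> 1/4"
      using zero_le_power2[of "u - 1/2"] by (simp add: power2_eq_square algebra_simps)
    then show ?thesis using d mult_left_mono[of "u * (1 - u)" "1/4" "4 * d"] by simp
  qed
  ultimately show "f u \<le> (1 - u) * f 0 + u * f 1 - k / 2 * u * (1 - u) + d"
    by (simp add: F_def k'_def field_simps)
qed

section \<open>Curvature of the excess of a coercive convex function over a level\<close>

text \<open>
  Level and argument form one pair so that second differences in a joint direction are instances of
  \<^const>\<open>second_diff\<close>.
\<close>

definition excess :: "('a \<Rightarrow> real) \<Rightarrow> 'a \<times> real \<Rightarrow> real" where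
  "excess \<phi> = (\<lambda>(t, \<eta>). max 0 (\<phi> t - \<eta>))"

lemma convex_on_excess:
  assumes "convex_on UNIV \<phi>"
  shows "convex_on UNIV (excess \<phi>)"
proof (rule convex_onI)
  fix u :: real and x y :: "'a \<times> real"
  assume u: "0 < u" "u < 1"
  obtain s a t b where xy: "x = (s, a)" "y = (t, b)" by fastforce
  have "\<phi> ((1 - u) *\<^sub>R s + u *\<^sub>R t) - ((1 - u) * a + u * b) \<le> (1 - u) * (\<phi> s - a) + u * (\<phi> t - b)"
    using convex_onD[OF assms, of u s t] u by (simp add: algebra_simps)
  also have "\<dots> \<le> (1 - u) * max 0 (\<phi> s - a) + u * max 0 (\<phi> t - b)"
    using u by (intro add_mono mult_left_mono) auto
  finally show "excess \<phi> ((1 - u) *\<^sub>R x + u *\<^sub>R y) \<le> (1 - u) * excess \<phi> x + u * excess \<phi> y"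
    using u by (simp add: xy excess_def add_nonneg_nonneg)
qed auto

lemma continuous_on_second_diff_excess:
  fixes \<phi> :: "'a::euclidean_space \<Rightarrow> real"
  assumes "convex_on UNIV \<phi>"
  shows "continuous_on UNIV (\<lambda>t. second_diff (excess \<phi>) w (t, \<eta>))"
proof -
  have "continuous_on UNIV (excess \<phi>)"
    by (intro convex_on_continuous convex_on_excess assms open_UNIV)
  then have "continuous_on UNIV (\<lambda>z. second_diff (excess \<phi>) w (z + 0))"
    by (rule continuous_on_second_diff)
  then show ?thesis
    by (intro continuous_on_compose2[where f = "\<lambda>t. (t, \<eta>)" and t = UNIV and g = "second_diff (excess \<phi>) w"])
       (auto intro!: continuous_intros)
qed

text \<open>
  Since second differences of the excess are nonnegative, their integral may be estimated on any part \<open>B\<close> of the ball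
  where they dominate those of a simpler function.
\<close>

lemma set_integral_second_diff_excess_mono:
  fixes \<phi> :: "'a::euclidean_space \<Rightarrow> real"
  assumes \<phi>: "convex_on UNIV \<phi>" and G: "convex_on UNIV G"
    and B: "B \<in> sets borel" "B \<subseteq> ball 0 \<rho>"
    and le: "\<And>t. t \<in> B \<Longrightarrow> second_diff G v t \<le> second_diff (excess \<phi>) w (t, \<eta>)"
  shows "(LINT t:B|lborel. second_diff G v t)
    \<le> (LINT t:ball 0 \<rho>|lborel. second_diff (excess \<phi>) w (t, \<eta>))"
proof -
  have bB: "bounded B" using B bounded_subset by blast
  have contG: "continuous_on UNIV G"
    by (intro convex_on_continuous G open_UNIV)
  have int: "set_integrable lborel A (\<lambda>t. second_diff (excess \<phi>) w (t, \<eta>))"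
    if "bounded A" "A \<in> sets borel" for A
    using that by (intro set_integrable_continuous_bounded continuous_on_second_diff_excess \<phi>)
  have "(LINT t:B|lborel. second_diff G v t) \<le> (LINT t:B|lborel. second_diff (excess \<phi>) w (t, \<eta>))"
    using set_integrable_continuous_bounded[OF continuous_on_second_diff[OF contG, of _ 0]] bB B
    by (intro set_integral_mono int le) auto
  also have "\<dots> \<le> (LINT t:ball 0 \<rho>|lborel. second_diff (excess \<phi>) w (t, \<eta>))"
    using B by (intro set_integral_mono_set_nonneg int second_diff_nonneg convex_on_excess \<phi>) auto
  finally show ?thesis .
qed

lemma set_integral_second_diff_excess_nonneg:
  fixes \<phi> :: "'a::euclidean_space \<Rightarrow> real"
  assumes "convex_on UNIV \<phi>"
  shows "0 \<le> (LINT t:A|lborel. second_diff (excess \<phi>) w (t, \<eta>))"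
  unfolding set_lebesgue_integral_def
  using second_diff_nonneg[OF convex_on_excess[OF assms]] by (intro integral_nonneg_AE) auto

text \<open>
  A lower bound \<open>m\<close> for the second derivative, in direction \<open>(h, \<delta>)\<close>, of the excess integrated over \<open>ball 0 \<rho>\<close>. How
  small the step has to be may depend on everything, including \<open>h\<close>, \<open>\<delta>\<close> and \<open>\<eta>\<close>.
\<close>

definition curvature_ge :: "('a::euclidean_space \<Rightarrow> real) \<Rightarrow> real \<Rightarrow> real \<Rightarrow> 'a \<Rightarrow> real \<Rightarrow> real \<Rightarrow> bool" where
  "curvature_ge \<phi> \<rho> \<eta> h \<delta> m \<longleftrightarrow> (\<forall>\<^sub>F e in at_right 0.
    m * e\<^sup>2 \<le> (LINT t:ball 0 \<rho>|lborel. second_diff (excess \<phi>) (e *\<^sub>R h, e * \<delta>) (t, \<eta>)))"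

lemma curvature_geI:
  assumes "0 < e0"
    and "\<And>e. 0 < e \<Longrightarrow> e < e0 \<Longrightarrow>
      m * e\<^sup>2 \<le> (LINT t:ball 0 \<rho>|lborel. second_diff (excess \<phi>) (e *\<^sub>R h, e * \<delta>) (t, \<eta>))"
  shows "curvature_ge \<phi> \<rho> \<eta> h \<delta> m"
  unfolding curvature_ge_def eventually_at_right_field using assms by blast

lemma curvature_ge_mono:
  assumes "curvature_ge \<phi> \<rho> \<eta> h \<delta> m" "m' \<le> m"
  shows "curvature_ge \<phi> \<rho> \<eta> h \<delta> m'"
  using assms(1) unfolding curvature_ge_def
proof (rule eventually_mono)
  fix e
  assume "m * e\<^sup>2 \<le> (LINT t:ball 0 \<rho>|lborel. second_diff (excess \<phi>) (e *\<^sub>R h, e * \<delta>) (t, \<eta>))"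
  moreover have "m' * e\<^sup>2 \<le> m * e\<^sup>2" using assms(2) by (rule mult_right_mono) simp
  ultimately show "m' * e\<^sup>2 \<le> (LINT t:ball 0 \<rho>|lborel. second_diff (excess \<phi>) (e *\<^sub>R h, e * \<delta>) (t, \<eta>))"
    by simp
qed

lemma curvature_ge_0:
  assumes "convex_on UNIV \<phi>"
  shows "curvature_ge \<phi> \<rho> \<eta> h \<delta> 0"
  using set_integral_second_diff_excess_nonneg[OF assms] by (auto simp: curvature_ge_def)

text \<open>
  The quantitative properties of the recourse value that its curvature depends on.
\<close>

locale coercive_convex =
  fixes \<phi> :: "'a::euclidean_space \<Rightarrow> real" and c L :: real
  assumes convex: "convex_on UNIV \<phi>"
    and lipschitz: "\<And>s t. \<phi> s - \<phi> t \<le> L * norm (s - t)"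
    and zero: "\<phi> 0 = 0"
    and c_pos: "0 < c" and coercive: "\<And>t. c * norm t \<le> \<phi> t"
begin

lemma upper: "\<phi> t \<le> L * norm t"
  using lipschitz[of t 0] zero by simp

lemma c_le_L: "c \<le> L"
proof -
  obtain b :: 'a where "b \<in> Basis" using nonempty_Basis by blast
  then show ?thesis
    using coercive[of b] upper[of b] by simp
qed

lemma L_pos: "0 < L"
  using c_pos c_le_L by simp

text \<open>
  At the two distant points \<open>t \<plusminus> s u\<close> coercivity makes \<open>\<phi>\<close> large, while close to the origin \<open>\<phi> t\<close> is small.
\<close>

lemma second_diff_lower_bound:
  assumes u: "norm u = 1" and t: "norm t \<le> c * T / (8 * L)" and s: "T / 2 \<le> s"
  shows "c * T / 2 \<le> second_diff \<phi> (s *\<^sub>R u) t"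
proof -
  have Lt: "8 * (L * norm t) \<le> c * T"
    using t L_pos by (simp add: field_simps)
  have ct: "c * norm t \<le> L * norm t"
    using c_le_L by (simp add: mult_right_mono)
  have cs: "c * T \<le> 2 * (c * s)"
    using s c_pos by simp
  have "norm (t + s *\<^sub>R u) \<ge> s - norm t" "norm (t - s *\<^sub>R u) \<ge> s - norm t"
    using norm_triangle_ineq2[of "s *\<^sub>R u" "- t"] norm_triangle_ineq2[of "s *\<^sub>R u" t] u
    by (auto simp: add.commute norm_minus_commute)
  then have "c * (s - norm t) \<le> c * norm (t + s *\<^sub>R u)" "c * (s - norm t) \<le> c * norm (t - s *\<^sub>R u)"
    using c_pos by auto
  then have "c * s - c * norm t \<le> \<phi> (t + s *\<^sub>R u)" "c * s - c * norm t \<le> \<phi> (t - s *\<^sub>R u)"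
    using coercive[of "t + s *\<^sub>R u"] coercive[of "t - s *\<^sub>R u"] by (auto simp: right_diff_distrib)
  with upper[of t] ct Lt cs show ?thesis
    unfolding second_diff_def by linarith
qed

text \<open>
  The curvature of \<open>\<phi>\<close> along \<open>h\<close> is collected in a tube around the segment through \<open>p\<close> of length \<open>2 * T\<close> in
  direction \<open>h\<close>. The radius \<open>\<sigma> / 2\<close> and the bound on \<open>p\<close> keep the axis of the tube near the origin compared with
  its length, as \<open>second_diff_lower_bound\<close> requires.
\<close>

lemma curvature_along_tube:
  assumes \<rho>: "0 < \<rho>" and T: "T = \<rho> / 2" and \<sigma>: "\<sigma> = c * T / (16 * L)" and h: "h \<noteq> 0"
    and p: "norm p \<le> \<sigma>" and e: "0 < e" "e * norm h \<le> T"
    and B: "B \<in> sets borel" "B \<subseteq> ball 0 \<rho>"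
    and tube: "\<And>t s. t \<in> ball p (\<sigma> / 2) \<Longrightarrow> \<bar>s\<bar> \<le> T \<Longrightarrow> t + s *\<^sub>R sgn h \<in> B"
    and le: "\<And>t. t \<in> B \<Longrightarrow> second_diff \<phi> (e *\<^sub>R h) t \<le> second_diff (excess \<phi>) w (t, \<eta>)"
  shows "c / (2 * T) * measure lborel (ball (0::'a) (\<sigma> / 2)) * (norm h)\<^sup>2 * e\<^sup>2
    \<le> (LINT t:ball 0 \<rho>|lborel. second_diff (excess \<phi>) w (t, \<eta>))"
proof -
  have pos: "0 < T" "0 < \<sigma>" using \<rho> c_pos L_pos by (auto simp: T \<sigma>)
  have sg: "sgn (e *\<^sub>R h) = sgn h" using e by (simp add: sgn_scaleR)
  have "(norm (e *\<^sub>R h))\<^sup>2 / T\<^sup>2 * (c * T / 2 * measure lborel (ball p (\<sigma> / 2)))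
    \<le> (LINT t:B|lborel. second_diff \<phi> (e *\<^sub>R h) t)"
  proof (rule integral_second_diff_lower_bound[OF convex])
    show "bounded B" using B bounded_subset by blast
    show "c * T / 2 \<le> second_diff \<phi> (s *\<^sub>R sgn (e *\<^sub>R h)) t"
      if "t \<in> ball p (\<sigma> / 2)" "T / 2 \<le> s" "s \<le> T" for t s
    proof (rule second_diff_lower_bound)
      have "norm t \<le> norm p + \<sigma> / 2"
        using that norm_triangle_ineq2[of t p] by (simp add: dist_norm norm_minus_commute)
      also have "\<dots> \<le> 2 * \<sigma>" using p pos by simp
      finally show "norm t \<le> c * T / (8 * L)" by (simp add: \<sigma> mult.commute)
    qed (use that h e in \<open>auto simp: norm_sgn\<close>)
  qed (use e h pos c_pos B tube in \<open>auto simp: sg\<close>)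
  also have "\<dots> \<le> (LINT t:ball 0 \<rho>|lborel. second_diff (excess \<phi>) w (t, \<eta>))"
    by (rule set_integral_second_diff_excess_mono[OF convex convex B le])
  finally show ?thesis
    using pos e by (simp add: content_ball power_mult_distrib power2_eq_square field_simps)
qed

text \<open>
  For \<open>\<eta> \<le> 0\<close> the excess at \<open>(t, \<eta>)\<close> equals \<open>\<phi> t - \<eta>\<close>, and at the shifted points it is at least that affine
  expression; so the second difference of the excess dominates that of \<open>\<phi>\<close>. This includes \<open>\<eta> = 0\<close>, where one of the
  shifted levels may be positive.
\<close>

lemma curvature_nonpositive_level:
  assumes \<rho>: "0 < \<rho>"
  shows "\<exists>k>0. \<forall>\<eta>\<le>0. \<forall>h \<delta>. curvature_ge \<phi> \<rho> \<eta> h \<delta> (k * (norm h)\<^sup>2)"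
proof -
  define T where "T = \<rho> / 2"
  define \<sigma> where "\<sigma> = c * T / (16 * L)"
  have T: "0 < T" using \<rho> by (simp add: T_def)
  have \<sigma>: "0 < \<sigma>" "\<sigma> \<le> T"
    using c_pos L_pos T c_le_L mult_right_mono[OF c_le_L, of T] by (auto simp: \<sigma>_def field_simps)
  define k where "k = c / (2 * T) * measure lborel (ball (0::'a) (\<sigma> / 2))"
  have "0 < k"
    using c_pos T \<sigma> by (simp add: k_def content_ball)
  moreover have "curvature_ge \<phi> \<rho> \<eta> h \<delta> (k * (norm h)\<^sup>2)"
    if \<eta>: "\<eta> \<le> 0" for \<eta> h \<delta>
  proof (cases "h = 0")
    case True
    then show ?thesis
      using curvature_ge_0[OF convex] by simp
  next
    case False
    have "k * (norm h)\<^sup>2 * e\<^sup>2 \<le> (LINT t:ball 0 \<rho>|lborel. second_diff (excess \<phi>) (e *\<^sub>R h, e * \<delta>) (t, \<eta>))"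
      if e: "0 < e" "e < T / norm h" for e
      unfolding k_def
    proof (rule curvature_along_tube[OF \<rho> T_def \<sigma>_def False, where p = 0 and B = "ball 0 \<rho>"])
      show "e * norm h \<le> T" using e False by (simp add: field_simps)
      show "t + s *\<^sub>R sgn h \<in> ball 0 \<rho>" if "t \<in> ball 0 (\<sigma> / 2)" "\<bar>s\<bar> \<le> T" for t s
        using that norm_triangle_ineq[of t "s *\<^sub>R sgn h"] False \<sigma> T by (simp add: norm_sgn T_def)
      have nonneg: "0 \<le> \<phi> t" for t
        using coercive[of t] c_pos by (smt (verit) mult_nonneg_nonneg norm_ge_zero)
      show "second_diff \<phi> (e *\<^sub>R h) t \<le> second_diff (excess \<phi>) (e *\<^sub>R h, e * \<delta>) (t, \<eta>)" for t
        using nonneg[of t] \<eta> by (simp add: second_diff_def excess_def)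
    qed (use \<sigma> e in auto)
    then show ?thesis
      using T False by (intro curvature_geI[of "T / norm h"]) auto
  qed
  ultimately show ?thesis by blast
qed

text \<open>
  For positive levels the excess is \<open>\<phi> t - \<eta>\<close> only away from the origin. In dimension at least two the tube can be shifted
  in a direction orthogonal to \<open>h\<close> and then avoids a neighbourhood of the origin that contains \<open>{t. \<phi> t \<le> \<eta>}\<close> for all low levels \<open>\<eta>\<close>.
\<close>

lemma curvature_low_level:
  assumes \<rho>: "0 < \<rho>" and dim: "2 \<le> DIM('a)"
  shows "\<exists>k>0. \<exists>\<eta>\<^sub>1>0. \<forall>\<eta>\<le>\<eta>\<^sub>1. \<forall>h \<delta>. curvature_ge \<phi> \<rho> \<eta> h \<delta> (k * (norm h)\<^sup>2)"
proof -
  define T where "T = \<rho> / 2"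
  define \<sigma> where "\<sigma> = c * T / (16 * L)"
  have T: "0 < T" using \<rho> by (simp add: T_def)
  have \<sigma>: "0 < \<sigma>" "\<sigma> \<le> T / 16"
    using c_pos L_pos T c_le_L mult_right_mono[OF c_le_L, of T] by (auto simp: \<sigma>_def field_simps)
  define k where "k = c / (2 * T) * measure lborel (ball (0::'a) (\<sigma> / 2))"
  define \<eta>\<^sub>1 where "\<eta>\<^sub>1 = c * \<sigma> / 8"
  have \<eta>1: "0 < \<eta>\<^sub>1" using c_pos \<sigma> by (simp add: \<eta>\<^sub>1_def)
  have "0 < k"
    using c_pos T \<sigma> by (simp add: k_def content_ball)
  moreover have "curvature_ge \<phi> \<rho> \<eta> h \<delta> (k * (norm h)\<^sup>2)"
    if \<eta>: "\<eta> \<le> \<eta>\<^sub>1" for \<eta> h \<delta>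
  proof (cases "h = 0")
    case True
    then show ?thesis
      using curvature_ge_0[OF convex] by simp
  next
    case False
    obtain w where w: "w \<noteq> 0" "orthogonal h w"
      using orthogonal_to_vector_exists[OF dim] by blast
    define p where "p = \<sigma> *\<^sub>R sgn w"
    have p: "norm p = \<sigma>" "p \<bullet> sgn h = 0"
      using w \<sigma> by (auto simp: p_def norm_sgn orthogonal_def sgn_div_norm inner_commute)
    define B where "B = ball 0 \<rho> \<inter> {t::'a. \<sigma> / 2 \<le> norm t}"
    \<comment> \<open>Neither the step in \<open>t\<close> nor the step in the level may bring \<open>\<phi>\<close> below the level: on \<open>B\<close>
      we have \<open>4 * \<eta>\<^sub>1 \<le> \<phi> t\<close>, each step costs at most \<open>\<eta>\<^sub>1\<close>, and the level itself is at most \<open>\<eta>\<^sub>1\<close>.\<close>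
    define e0 where "e0 = min (T / norm h) (min (\<eta>\<^sub>1 / (L * norm h)) (\<eta>\<^sub>1 / (\<bar>\<delta>\<bar> + 1)))"
    have "k * (norm h)\<^sup>2 * e\<^sup>2 \<le> (LINT t:ball 0 \<rho>|lborel. second_diff (excess \<phi>) (e *\<^sub>R h, e * \<delta>) (t, \<eta>))"
      if e: "0 < e" "e < e0" for e
      unfolding k_def
    proof (rule curvature_along_tube[OF \<rho> T_def \<sigma>_def False, where p = p and B = B])
      show "e * norm h \<le> T" using e False by (simp add: e0_def field_simps)
      show "t + s *\<^sub>R sgn h \<in> B" if t: "t \<in> ball p (\<sigma> / 2)" and s: "\<bar>s\<bar> \<le> T" for t s
      proof -
        have "(norm (p + s *\<^sub>R sgn h))\<^sup>2 = \<sigma>\<^sup>2 + s\<^sup>2"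
        proof -
          have "(norm (p + s *\<^sub>R sgn h))\<^sup>2 = (norm p)\<^sup>2 + (norm (s *\<^sub>R sgn h))\<^sup>2"
            by (rule norm_add_Pythagorean) (simp add: orthogonal_def p(2))
          then show ?thesis using False by (simp add: p(1) norm_sgn)
        qed
        then have "\<sigma> \<le> norm (p + s *\<^sub>R sgn h)"
          by - (rule power2_le_imp_le, simp_all)
        moreover have "norm (p + s *\<^sub>R sgn h) \<le> \<sigma> + T"
          using norm_triangle_ineq[of p "s *\<^sub>R sgn h"] p False s by (simp add: norm_sgn)
        moreover have "norm (p - t) < \<sigma> / 2" using t by (simp add: dist_norm)
        moreover have "norm (t + s *\<^sub>R sgn h) \<le> norm (p + s *\<^sub>R sgn h) + norm (p - t)"
          "norm (p + s *\<^sub>R sgn h) \<le> norm (t + s *\<^sub>R sgn h) + norm (p - t)"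
          using norm_triangle_ineq4[of "p + s *\<^sub>R sgn h" "p - t"]
            norm_triangle_ineq[of "t + s *\<^sub>R sgn h" "p - t"] by (simp_all add: add.commute)
        ultimately show ?thesis
          using \<sigma> T by (simp add: B_def T_def)
      qed
      show "second_diff \<phi> (e *\<^sub>R h) t \<le> second_diff (excess \<phi>) (e *\<^sub>R h, e * \<delta>) (t, \<eta>)" if t: "t \<in> B" for t
      proof -
        have "e * (L * norm h) \<le> \<eta>\<^sub>1"
          using e False L_pos by (simp add: e0_def field_simps)
        then have Lh: "L * norm (e *\<^sub>R h) \<le> \<eta>\<^sub>1" using e by (simp add: mult_ac)
        have "e * (\<bar>\<delta>\<bar> + 1) \<le> \<eta>\<^sub>1"
          using e by (simp add: e0_def field_simps)
        then have "\<bar>e * \<delta>\<bar> \<le> \<eta>\<^sub>1" using e by (simp add: abs_mult distrib_left)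
        then have d: "e * \<delta> \<le> \<eta>\<^sub>1" "- (e * \<delta>) \<le> \<eta>\<^sub>1" by auto
        have "c * (\<sigma> / 2) \<le> c * norm t" using t c_pos by (simp add: B_def)
        then have "4 * \<eta>\<^sub>1 \<le> \<phi> t" using coercive[of t] by (simp add: \<eta>\<^sub>1_def mult.commute)
        moreover have "\<phi> t - \<phi> (t + e *\<^sub>R h) \<le> \<eta>\<^sub>1" "\<phi> t - \<phi> (t - e *\<^sub>R h) \<le> \<eta>\<^sub>1"
          using lipschitz[of t "t + e *\<^sub>R h"] lipschitz[of t "t - e *\<^sub>R h"] Lh by auto
        ultimately show ?thesis
          using d \<eta> \<eta>1 by (simp add: second_diff_def excess_def max_def)
      qed
    qed (use \<sigma> e p in \<open>auto simp: B_def\<close>)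
    then show ?thesis
      using T False \<eta>1 L_pos by (intro curvature_geI[of e0]) (auto simp: e0_def)
  qed
  ultimately show ?thesis using \<eta>1 by blast
qed

end

lemma second_diff_hinge:
  "second_diff (\<lambda>t. max 0 (d \<bullet> t - \<eta>)) v t = max 0 (\<bar>d \<bullet> v\<bar> - \<bar>d \<bullet> t - \<eta>\<bar>)"
  by (simp add: second_diff_def inner_add_right inner_diff_right) (simp add: max_def abs_if)

lemma convex_on_hinge: "convex_on UNIV (\<lambda>t. max 0 (d \<bullet> t - \<eta>))"
proof (rule convex_onI)
  fix u :: real and x y :: 'a assume u: "0 < u" "u < 1"
  have "d \<bullet> ((1 - u) *\<^sub>R x + u *\<^sub>R y) - \<eta> = (1 - u) * (d \<bullet> x - \<eta>) + u * (d \<bullet> y - \<eta>)"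
    by (simp add: inner_add_right algebra_simps)
  also have "\<dots> \<le> (1 - u) * max 0 (d \<bullet> x - \<eta>) + u * max 0 (d \<bullet> y - \<eta>)"
    using u by (intro add_mono mult_left_mono) auto
  finally show "max 0 (d \<bullet> ((1 - u) *\<^sub>R x + u *\<^sub>R y) - \<eta>)
    \<le> (1 - u) * max 0 (d \<bullet> x - \<eta>) + u * max 0 (d \<bullet> y - \<eta>)"
    using u by (simp add: add_nonneg_nonneg)
qed auto

context coercive_convex
begin

text \<open>
  In the cone where \<open>\<phi> = d \<bullet> t\<close> the excess depends on \<open>(t, \<eta>)\<close> only through \<open>d \<bullet> t - \<eta>\<close>. Hence the joint direction
  \<open>(h, \<delta>)\<close> may be traded for a direction \<open>v\<close> in \<open>t\<close> alone, chosen parallel to \<open>d\<close> so that it crosses the level set. The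
  ball around \<open>b\<close> at level \<open>\<eta>\<^sub>0\<close> is scaled by \<open>\<eta> / \<eta>\<^sub>0\<close>; its volume loses the dimension-th power of this factor, of which
  one power is regained because the height of the hat function, relative to the squared scale, grows.
\<close>

lemma curvature_across_level_set:
  assumes homogeneous: "\<And>r t. 0 \<le> r \<Longrightarrow> \<phi> (r *\<^sub>R t) = r * \<phi> t"
    and \<eta>0: "0 < \<eta>\<^sub>0" and T: "0 < T" and b: "d \<bullet> b = \<eta>\<^sub>0"
    and cone: "ball b (2 * T) \<subseteq> ball 0 \<rho> \<inter> {t. \<phi> t = d \<bullet> t}"
  shows "\<exists>k>0. \<forall>\<eta>. 0 < \<eta> \<longrightarrow> \<eta> \<le> \<eta>\<^sub>0 \<longrightarrow> (\<forall>h \<delta>.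
    curvature_ge \<phi> \<rho> \<eta> h \<delta> (k * (\<eta> / \<eta>\<^sub>0) ^ (DIM('a) - 1) * (d \<bullet> h - \<delta>)\<^sup>2))"
proof -
  define n where "n = DIM('a) - 1"
  have n: "DIM('a) = Suc n" by (simp add: n_def)
  have d: "d \<noteq> 0" using b \<eta>0 by auto
  define k where "k = unit_ball_vol (real DIM('a)) * T ^ n / (norm d * 4 ^ (Suc (Suc n)))"
  have "0 < k" using T d by (simp add: k_def)
  moreover have "curvature_ge \<phi> \<rho> \<eta> h \<delta> (k * (\<eta> / \<eta>\<^sub>0) ^ n * (d \<bullet> h - \<delta>)\<^sup>2)"
    if \<eta>: "0 < \<eta>" "\<eta> \<le> \<eta>\<^sub>0" for \<eta> h \<delta>
  proof (cases "d \<bullet> h = \<delta>")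
    case True
    then show ?thesis
      using curvature_ge_0[OF convex] by simp
  next
    case False
    define \<tau> where "\<tau> = \<eta> / \<eta>\<^sub>0"
    have \<tau>: "0 < \<tau>" "\<tau> \<le> 1" using \<eta> \<eta>0 by (auto simp: \<tau>_def)
    define S where "S = \<tau> * T"
    define p where "p = \<tau> *\<^sub>R b"
    have S: "0 < S" using \<tau> T by (simp add: S_def)
    have dp: "d \<bullet> p = \<eta>" using b \<eta>0 by (simp add: p_def \<tau>_def)
    have scaled: "t \<in> ball 0 \<rho> \<and> \<phi> t = d \<bullet> t" if t: "t \<in> ball p (2 * S)" for t
    proof -
      have "p - t = \<tau> *\<^sub>R (b - (1 / \<tau>) *\<^sub>R t)"
        using \<tau> by (simp add: p_def scaleR_right_diff_distrib)
      then have "dist b ((1 / \<tau>) *\<^sub>R t) = dist p t / \<tau>"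
        using \<tau> by (simp add: dist_norm)
      also have "\<dots> < 2 * T" using t \<tau> by (simp add: S_def field_simps)
      finally have in_ball: "(1 / \<tau>) *\<^sub>R t \<in> ball 0 \<rho>" and "\<phi> ((1 / \<tau>) *\<^sub>R t) = d \<bullet> ((1 / \<tau>) *\<^sub>R t)"
        using cone by auto
      then have "\<phi> t = d \<bullet> t" using homogeneous[of "1 / \<tau>" t] \<tau> by simp
      moreover have "norm t \<le> norm t / \<tau>" using \<tau> by (simp add: field_simps mult_left_le_one_le)
      ultimately show ?thesis using in_ball \<tau> by simp
    qed
    define a0 where "a0 = \<bar>d \<bullet> h - \<delta>\<bar>"
    have a0: "0 < a0" using False by (simp add: a0_def)
    \<comment> \<open>The first bound makes \<open>norm v \<le> S\<close>; the second keeps \<open>t \<plusminus> e h\<close> inside the scaled ball.\<close>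
    define e0 where "e0 = min (norm d * S / a0) (S / (2 * (norm h + 1)))"
    have "k * \<tau> ^ n * (d \<bullet> h - \<delta>)\<^sup>2 * e\<^sup>2
        \<le> (LINT t:ball 0 \<rho>|lborel. second_diff (excess \<phi>) (e *\<^sub>R h, e * \<delta>) (t, \<eta>))"
      if e: "0 < e" "e < e0" for e
    proof -
      \<comment> \<open>Shifting \<open>t\<close> by \<open>v\<close> changes \<open>d \<bullet> t - \<eta>\<close> exactly as the joint step does.\<close>
      define v where "v = (e * (d \<bullet> h - \<delta>) / (norm d)\<^sup>2) *\<^sub>R d"
      define G where "G = (\<lambda>t. max 0 (d \<bullet> t - \<eta>))"
      have dv: "d \<bullet> v = e * (d \<bullet> h - \<delta>)"
        using d by (simp add: v_def power2_norm_eq_inner)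
      have nv: "norm v = e * a0 / norm d"
        using e d by (simp add: v_def a0_def abs_mult power2_eq_square)
      have nv_pos: "0 < norm v" using nv e a0 d by simp
      have nv_le: "norm v \<le> S"
        using e a0 d by (simp add: nv e0_def field_simps)
      have sgnv: "\<bar>d \<bullet> sgn v\<bar> = norm d"
      proof -
        have "\<bar>d \<bullet> sgn v\<bar> = \<bar>d \<bullet> v\<bar> / norm v"
          by (simp add: sgn_div_norm abs_mult divide_inverse_commute)
        also have "\<dots> = norm d"
          using nv_pos e d a0 by (simp add: dv nv abs_mult flip: a0_def)
        finally show ?thesis .
      qed
      have eh: "norm (e *\<^sub>R h) \<le> S / 2"
      proof -
        have "0 < 2 * (norm h + 1)" by (simp add: add_nonneg_pos)
        moreover have "e < S / (2 * (norm h + 1))" using e by (simp add: e0_def)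
        ultimately have "e * (2 * (norm h + 1)) < S" by (simp only: pos_less_divide_eq)
        then have "e * (norm h + 1) \<le> S / 2" by (simp add: algebra_simps)
        then show ?thesis using e by (simp add: distrib_left)
      qed
      have B: "ball p (3 / 2 * S) \<subseteq> ball 0 \<rho>"
        using scaled S by (auto simp: ball_def)
      have "(norm v)\<^sup>2 / S\<^sup>2 * (norm d * S / 4 * measure lborel (ball p (S / 4)))
        \<le> (LINT t:ball p (3 / 2 * S)|lborel. second_diff G v t)"
      proof (rule integral_second_diff_lower_bound[OF _ nv_pos nv_le])
        show "convex_on UNIV G" unfolding G_def by (rule convex_on_hinge)
        show "t + s *\<^sub>R sgn v \<in> ball p (3 / 2 * S)" if t: "t \<in> ball p (S / 4)" and s: "\<bar>s\<bar> \<le> S" for t s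
        proof -
          have "norm (p - (t + s *\<^sub>R sgn v)) \<le> norm (p - t) + norm (s *\<^sub>R sgn v)"
            using norm_triangle_ineq4[of "p - t" "s *\<^sub>R sgn v"] by (simp add: algebra_simps)
          also have "norm (s *\<^sub>R sgn v) \<le> S" using s nv_pos by (simp add: norm_sgn)
          finally show ?thesis using t S by (simp add: dist_norm)
        qed
        show "norm d * S / 4 \<le> second_diff G (s *\<^sub>R sgn v) t"
          if t: "t \<in> ball p (S / 4)" and s: "S / 2 \<le> s" "s \<le> S" for t s
        proof -
          have "\<bar>d \<bullet> t - \<eta>\<bar> = \<bar>d \<bullet> (t - p)\<bar>" by (simp add: dp inner_diff_right)
          also have "\<dots> \<le> norm d * norm (t - p)" by (rule Cauchy_Schwarz_ineq2)
          also have "\<dots> \<le> norm d * (S / 4)"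
            using t by (intro mult_left_mono) (auto simp: dist_norm norm_minus_commute)
          finally have 1: "\<bar>d \<bullet> t - \<eta>\<bar> \<le> norm d * (S / 4)" .
          have "\<bar>d \<bullet> (s *\<^sub>R sgn v)\<bar> = s * norm d"
            using s S sgnv by (simp add: abs_mult)
          also have "\<dots> \<ge> S / 2 * norm d"
            using s by (intro mult_right_mono) auto
          finally have "norm d * S / 4 \<le> \<bar>d \<bullet> (s *\<^sub>R sgn v)\<bar> - \<bar>d \<bullet> t - \<eta>\<bar>"
            using 1 by (simp add: mult.commute)
          then show ?thesis
            unfolding G_def second_diff_hinge by (rule max.coboundedI2)
        qed
      qed (use S in auto)
      also have "\<dots> \<le> (LINT t:ball 0 \<rho>|lborel. second_diff (excess \<phi>) (e *\<^sub>R h, e * \<delta>) (t, \<eta>))"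
      proof (rule set_integral_second_diff_excess_mono[OF convex _ _ B])
        show "convex_on UNIV G" unfolding G_def by (rule convex_on_hinge)
        show "second_diff G v t \<le> second_diff (excess \<phi>) (e *\<^sub>R h, e * \<delta>) (t, \<eta>)"
          if t: "t \<in> ball p (3 / 2 * S)" for t
        proof -
          have "t \<in> ball p (2 * S)" using t S by simp
          moreover have "t + e *\<^sub>R h \<in> ball p (2 * S)" "t - e *\<^sub>R h \<in> ball p (2 * S)"
            using t eh norm_triangle_ineq4[of "p - t" "e *\<^sub>R h"] norm_triangle_ineq[of "p - t" "e *\<^sub>R h"]
            by (auto simp: dist_norm algebra_simps)
          ultimately have "\<phi> t = d \<bullet> t" "\<phi> (t + e *\<^sub>R h) = d \<bullet> t + e * (d \<bullet> h)"
            "\<phi> (t - e *\<^sub>R h) = d \<bullet> t - e * (d \<bullet> h)"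
            using scaled by (auto simp: inner_add_right inner_diff_right)
          then show ?thesis
            by (simp add: second_diff_def excess_def G_def inner_add_right inner_diff_right dv algebra_simps)
        qed
      qed auto
      also have "(norm v)\<^sup>2 / S\<^sup>2 * (norm d * S / 4 * measure lborel (ball p (S / 4)))
        = k * \<tau> ^ n * (d \<bullet> h - \<delta>)\<^sup>2 * e\<^sup>2"
      proof -
        have vol: "measure lborel (ball p (S / 4)) = unit_ball_vol (real DIM('a)) * (S / 4) ^ Suc n"
          using S by (simp add: content_ball n)
        have "(norm v)\<^sup>2 / S\<^sup>2 * (norm d * S / 4 * measure lborel (ball p (S / 4)))
          = (e * a0 / norm d)\<^sup>2 / S\<^sup>2 * (norm d * S / 4 * (unit_ball_vol (real DIM('a)) * (S / 4) ^ Suc n))"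
          by (simp only: nv vol)
        also have "\<dots> = unit_ball_vol (real DIM('a)) * S ^ n / (norm d * 4 ^ Suc (Suc n)) * e\<^sup>2 * a0\<^sup>2"
          using d S by (simp add: power_divide power_mult_distrib power2_eq_square field_simps)
        also have "\<dots> = k * \<tau> ^ n * e\<^sup>2 * a0\<^sup>2"
          by (simp add: k_def S_def power_mult_distrib)
        finally show ?thesis by (simp add: a0_def mult_ac)
      qed
      finally show ?thesis .
    qed
    moreover have "0 < e0"
      using S d a0 by (simp add: e0_def add_nonneg_pos)
    ultimately show ?thesis
      unfolding \<tau>_def by (intro curvature_geI[of e0])
  qed
  ultimately show ?thesis unfolding n_def by blast
qed

text \<open>
  The bound for one vertex \<open>d\<close> vanishes in directions with \<open>d \<bullet> h = \<delta>\<close>. Coercivity at \<open>h\<close> and at \<open>- h\<close> provides two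
  vertices that cannot both be nearly degenerate in this sense.
\<close>

lemma curvature_positive_level:
  assumes homogeneous: "\<And>r t. 0 \<le> r \<Longrightarrow> \<phi> (r *\<^sub>R t) = r * \<phi> t"
    and P: "finite P" and cover: "\<And>t. \<exists>d\<in>P. \<phi> t = d \<bullet> t"
    and \<eta>0: "0 < \<eta>\<^sub>0"
    and window: "\<And>d. d \<in> P \<Longrightarrow> \<exists>b R. 0 < R \<and> d \<bullet> b = \<eta>\<^sub>0 \<and> ball b R \<subseteq> ball 0 \<rho> \<inter> {t. \<phi> t = d \<bullet> t}"
  shows "\<exists>k>0. \<forall>\<eta>. 0 < \<eta> \<longrightarrow> \<eta> \<le> \<eta>\<^sub>0 \<longrightarrow> (\<forall>h \<delta>.
    curvature_ge \<phi> \<rho> \<eta> h \<delta> (k * (\<eta> / \<eta>\<^sub>0) ^ (DIM('a) - 1) * (norm h)\<^sup>2))"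
proof -
  let ?ok = "\<lambda>d k. 0 < k \<and> (\<forall>\<eta>. 0 < \<eta> \<longrightarrow> \<eta> \<le> \<eta>\<^sub>0 \<longrightarrow> (\<forall>h \<delta>.
    curvature_ge \<phi> \<rho> \<eta> h \<delta> (k * (\<eta> / \<eta>\<^sub>0) ^ (DIM('a) - 1) * (d \<bullet> h - \<delta>)\<^sup>2)))"
  have "\<exists>k. ?ok d k" if d: "d \<in> P" for d
  proof -
    obtain b R where bR: "0 < R" "d \<bullet> b = \<eta>\<^sub>0" "ball b R \<subseteq> ball 0 \<rho> \<inter> {t. \<phi> t = d \<bullet> t}"
      using window[OF d] by blast
    then show ?thesis
      using curvature_across_level_set[OF homogeneous \<eta>0, of "R / 2" d b \<rho>] by simp
  qed
  then obtain K where K: "\<And>d. d \<in> P \<Longrightarrow> ?ok d (K d)" by metis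
  have ne: "P \<noteq> {}" using cover by blast
  define k where "k = Min (K ` P)"
  have k: "0 < k" "\<And>d. d \<in> P \<Longrightarrow> k \<le> K d"
    using K P ne by (auto simp: k_def)
  have "curvature_ge \<phi> \<rho> \<eta> h \<delta> ((k * c\<^sup>2) * (\<eta> / \<eta>\<^sub>0) ^ (DIM('a) - 1) * (norm h)\<^sup>2)"
    if \<eta>: "0 < \<eta>" "\<eta> \<le> \<eta>\<^sub>0" for \<eta> h \<delta>
  proof -
    obtain d d' where d: "d \<in> P" "\<phi> h = d \<bullet> h" "d' \<in> P" "\<phi> (- h) = d' \<bullet> (- h)"
      using cover by blast
    have "c * norm h \<le> d \<bullet> h" "d' \<bullet> h \<le> - (c * norm h)"
      using coercive[of h] coercive[of "- h"] d by auto
    then have "c * norm h \<le> \<bar>d \<bullet> h - \<delta>\<bar> \<or> c * norm h \<le> \<bar>d' \<bullet> h - \<delta>\<bar>"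
      by linarith
    then obtain g where g: "g \<in> P" "c * norm h \<le> \<bar>g \<bullet> h - \<delta>\<bar>"
      using d by blast
    have sq: "c\<^sup>2 * (norm h)\<^sup>2 \<le> (g \<bullet> h - \<delta>)\<^sup>2"
      using power_mono[OF g(2), of 2] c_pos by (simp add: power_mult_distrib)
    have "curvature_ge \<phi> \<rho> \<eta> h \<delta> (K g * (\<eta> / \<eta>\<^sub>0) ^ (DIM('a) - 1) * (g \<bullet> h - \<delta>)\<^sup>2)"
      using K[OF g(1)] \<eta> by blast
    moreover have "(k * c\<^sup>2) * (\<eta> / \<eta>\<^sub>0) ^ (DIM('a) - 1) * (norm h)\<^sup>2
      \<le> K g * (\<eta> / \<eta>\<^sub>0) ^ (DIM('a) - 1) * (g \<bullet> h - \<delta>)\<^sup>2"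
    proof -
      have "k * (c\<^sup>2 * (norm h)\<^sup>2) \<le> K g * (g \<bullet> h - \<delta>)\<^sup>2"
        using k(1) k(2)[OF g(1)] by (intro mult_mono sq) auto
      then have "(\<eta> / \<eta>\<^sub>0) ^ (DIM('a) - 1) * (k * (c\<^sup>2 * (norm h)\<^sup>2))
        \<le> (\<eta> / \<eta>\<^sub>0) ^ (DIM('a) - 1) * (K g * (g \<bullet> h - \<delta>)\<^sup>2)"
        using \<eta> \<eta>0 by (intro mult_left_mono) auto
      then show ?thesis by (simp add: mult_ac)
    qed
    ultimately show ?thesis by (rule curvature_ge_mono)
  qed
  then show ?thesis
    using k c_pos by (intro exI[of _ "k * c\<^sup>2"]) auto
qed

text \<open>
  Low levels are covered by the kink of \<open>\<phi>\<close> at the origin, the others by the level sets. In dimension one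
  the level-set bound carries the exponent \<open>0\<close>, so the threshold \<open>\<eta>\<^sub>1 = 0\<close> is enough.
\<close>

lemma uniform_curvature:
  assumes homogeneous: "\<And>r t. 0 \<le> r \<Longrightarrow> \<phi> (r *\<^sub>R t) = r * \<phi> t"
    and P: "finite P" and cover: "\<And>t. \<exists>d\<in>P. \<phi> t = d \<bullet> t"
    and \<eta>0: "0 < \<eta>\<^sub>0" and \<rho>: "0 < \<rho>"
    and window: "\<And>d. d \<in> P \<Longrightarrow> \<exists>b R. 0 < R \<and> d \<bullet> b = \<eta>\<^sub>0 \<and> ball b R \<subseteq> ball 0 \<rho> \<inter> {t. \<phi> t = d \<bullet> t}"
  shows "\<exists>k>0. \<forall>\<eta>\<le>\<eta>\<^sub>0. \<forall>h \<delta>. curvature_ge \<phi> \<rho> \<eta> h \<delta> (k * (norm h)\<^sup>2)"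
proof -
  let ?n = "DIM('a) - 1"
  obtain k2 where k2: "0 < k2" "\<And>\<eta> h \<delta>. 0 < \<eta> \<Longrightarrow> \<eta> \<le> \<eta>\<^sub>0 \<Longrightarrow>
      curvature_ge \<phi> \<rho> \<eta> h \<delta> (k2 * (\<eta> / \<eta>\<^sub>0) ^ ?n * (norm h)\<^sup>2)"
  proof -
    have "\<exists>k>0. \<forall>\<eta>. 0 < \<eta> \<longrightarrow> \<eta> \<le> \<eta>\<^sub>0 \<longrightarrow>
      (\<forall>h \<delta>. curvature_ge \<phi> \<rho> \<eta> h \<delta> (k * (\<eta> / \<eta>\<^sub>0) ^ ?n * (norm h)\<^sup>2))"
      by (rule curvature_positive_level[OF _ P cover \<eta>0]) (use homogeneous window in auto)
    then show ?thesis using that by blast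
  qed
  obtain k1 \<eta>\<^sub>1 where k1: "0 < k1" "\<And>\<eta> h \<delta>. \<eta> \<le> \<eta>\<^sub>1 \<Longrightarrow> curvature_ge \<phi> \<rho> \<eta> h \<delta> (k1 * (norm h)\<^sup>2)"
    and \<eta>1: "0 \<le> \<eta>\<^sub>1" "0 < \<eta>\<^sub>1 \<or> ?n = 0"
  proof (cases "2 \<le> DIM('a)")
    case True
    from curvature_low_level[OF \<rho> True] obtain k \<eta>\<^sub>1 where
      "0 < k" "0 < \<eta>\<^sub>1" "\<And>\<eta> h \<delta>. \<eta> \<le> \<eta>\<^sub>1 \<Longrightarrow> curvature_ge \<phi> \<rho> \<eta> h \<delta> (k * (norm h)\<^sup>2)"
      by blast
    then show ?thesis using that[of k \<eta>\<^sub>1] by simp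
  next
    case False
    from curvature_nonpositive_level[OF \<rho>] obtain k where
      "0 < k" "\<And>\<eta> h \<delta>. \<eta> \<le> 0 \<Longrightarrow> curvature_ge \<phi> \<rho> \<eta> h \<delta> (k * (norm h)\<^sup>2)"
      by blast
    then show ?thesis using that[of k 0] False by simp
  qed
  define k where "k = min k1 (k2 * (\<eta>\<^sub>1 / \<eta>\<^sub>0) ^ ?n)"
  have "0 < k" using k1(1) k2(1) \<eta>1 \<eta>0 by (auto simp: k_def)
  moreover have "curvature_ge \<phi> \<rho> \<eta> h \<delta> (k * (norm h)\<^sup>2)"
    if \<eta>: "\<eta> \<le> \<eta>\<^sub>0" for \<eta> h \<delta>
  proof (cases "\<eta> \<le> \<eta>\<^sub>1")
    case True
    show ?thesis
      by (rule curvature_ge_mono[OF k1(2)[OF True]]) (auto simp: k_def intro: mult_right_mono)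
  next
    case False
    then have pos: "0 < \<eta>" using \<eta>1 by simp
    have "(\<eta>\<^sub>1 / \<eta>\<^sub>0) ^ ?n \<le> (\<eta> / \<eta>\<^sub>0) ^ ?n"
      using False \<eta>0 \<eta>1 by (intro power_mono divide_right_mono) auto
    then have "k \<le> k2 * (\<eta> / \<eta>\<^sub>0) ^ ?n"
      using k2(1) by (simp add: k_def min.coboundedI2)
    then show ?thesis
      by (intro curvature_ge_mono[OF k2(2)[OF pos \<eta>]] mult_right_mono) auto
  qed
  ultimately show ?thesis by blast
qed

end

section \<open>The recourse value as the support function of the dual polytope\<close>

text \<open>
  A Hahn-Banach statement: separate the point \<open>(t, \<phi> t)\<close> from the strict epigraph. Homogeneity, used at \<open>0\<close> and at \<open>2 t\<close>,
  turns the supporting affine function into a linear one.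
\<close>

lemma sublinear_support:
  fixes \<phi> :: "'a::euclidean_space \<Rightarrow> real"
  assumes homogeneous: "\<And>r t. 0 \<le> r \<Longrightarrow> \<phi> (r *\<^sub>R t) = r * \<phi> t"
    and subadditive: "\<And>s t. \<phi> (s + t) \<le> \<phi> s + \<phi> t"
  obtains v where "v \<bullet> t = \<phi> t" "\<And>x. v \<bullet> x \<le> \<phi> x"
proof -
  \<comment> \<open>The inequality is strict so that \<open>(t, \<phi> t)\<close> lies outside and the two convex sets are disjoint.\<close>
  define S where "S = {(x, r). \<phi> x < r}"
  have "convex S"
  proof (rule convexI)
    fix a b :: "'a \<times> real" and u v :: real
    assume a: "a \<in> S" "b \<in> S" and uv: "0 \<le> u" "0 \<le> v" "u + v = 1"
    have "\<phi> (u *\<^sub>R fst a + v *\<^sub>R fst b) \<le> u * \<phi> (fst a) + v * \<phi> (fst b)"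
      using subadditive[of "u *\<^sub>R fst a" "v *\<^sub>R fst b"] homogeneous uv by simp
    also have "\<dots> < u * snd a + v * snd b"
    proof (cases "u = 0")
      case False
      then have "u * \<phi> (fst a) < u * snd a" using uv a by (auto simp: S_def)
      moreover have "v * \<phi> (fst b) \<le> v * snd b" using uv a by (auto simp: S_def intro: mult_left_mono)
      ultimately show ?thesis by simp
    qed (use uv a in \<open>auto simp: S_def\<close>)
    finally show "u *\<^sub>R a + v *\<^sub>R b \<in> S" by (simp add: S_def case_prod_beta)
  qed
  moreover have "(t, \<phi> t + 1) \<in> S" by (simp add: S_def)
  moreover have "{(t, \<phi> t)} \<inter> S = {}" by (simp add: S_def)
  ultimately have "\<exists>a b. a \<noteq> 0 \<and> (\<forall>x\<in>{(t, \<phi> t)}. a \<bullet> x \<le> b) \<and> (\<forall>x\<in>S. b \<le> a \<bullet> x)"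
    by (intro separating_hyperplane_sets convex_singleton) blast+
  then obtain a b where ab: "a \<noteq> 0" "a \<bullet> (t, \<phi> t) \<le> b" "\<And>x. x \<in> S \<Longrightarrow> b \<le> a \<bullet> x"
    by blast
  obtain w \<beta> where a: "a = (w, \<beta>)" by fastforce
  have sep: "w \<bullet> t + \<beta> * \<phi> t \<le> w \<bullet> x + \<beta> * r" if "\<phi> x < r" for x r
    using ab(2) ab(3)[of "(x, r)"] that by (simp add: a S_def)
  have "\<beta> \<ge> 0"
    using sep[of t "\<phi> t + 1"] by (simp add: distrib_left)
  moreover have "\<beta> \<noteq> 0"
  proof
    assume \<beta>: "\<beta> = 0"
    have "w \<bullet> t \<le> w \<bullet> (t - w)"
      using sep[of "t - w" "\<phi> (t - w) + 1"] by (simp add: \<beta>)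
    then have "w \<bullet> w = 0" using inner_ge_zero[of w] by (simp add: inner_diff_right)
    then have "w = 0" by simp
    with \<beta> ab(1) a show False by (simp add: prod_eq_iff)
  qed
  ultimately have \<beta>: "\<beta> > 0" by simp
  define v where "v = (- 1 / \<beta>) *\<^sub>R w"
  have key: "\<phi> t - v \<bullet> t \<le> \<phi> x - v \<bullet> x" for x
  proof (rule field_le_epsilon)
    fix e :: real assume e: "0 < e"
    have "w \<bullet> t + \<beta> * \<phi> t \<le> w \<bullet> x + \<beta> * (\<phi> x + e)" using sep[of x "\<phi> x + e"] e by simp
    moreover have "w \<bullet> y = - \<beta> * (v \<bullet> y)" for y using \<beta> by (simp add: v_def)
    ultimately have "\<beta> * (\<phi> t - v \<bullet> t) \<le> \<beta> * (\<phi> x - v \<bullet> x + e)" by (simp add: algebra_simps)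
    then show "\<phi> t - v \<bullet> t \<le> \<phi> x - v \<bullet> x + e" using \<beta> by simp
  qed
  have "\<phi> t - v \<bullet> t \<le> 0" using key[of 0] homogeneous[of 0 0] by simp
  moreover have "0 \<le> \<phi> t - v \<bullet> t" using key[of "2 *\<^sub>R t"] homogeneous[of 2 t] by simp
  ultimately have "v \<bullet> t = \<phi> t" by simp
  moreover from this have "v \<bullet> x \<le> \<phi> x" for x using key[of x] by simp
  ultimately show ?thesis by (rule that)
qed

lemma interior_Union_closed_empty:
  assumes "finite F" "\<And>S. S \<in> F \<Longrightarrow> closed S \<and> interior S = {}"
  shows "interior (\<Union>F) = {}"
  using assms
proof (induction F)
  case (insert S F)
  then show ?case by (simp add: interior_closed_Un_empty_interior)
qed simp

lemma open_has_nonzero: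
  fixes S :: "'a::euclidean_space set"
  assumes "open S" "S \<noteq> {}"
  shows "\<exists>z\<in>S. z \<noteq> 0"
proof (rule ccontr)
  assume "\<not> ?thesis"
  with assms(2) have "S = {0}" by auto
  with assms(1) not_open_singleton[of "0::'a"] show False by simp
qed

text \<open>
  If a point of the ray through \<open>e\<close> lies between \<open>a\<close> and \<open>b\<close>, rescale both to the slice; then \<open>e\<close> is a convex
  combination of the rescaled points, and extremality forces them to coincide with \<open>e\<close>. Positivity of \<open>d\<close> on \<open>K\<close> makes the
  rescaling possible.
\<close>

lemma extreme_point_of_slice_spans_face:
  fixes K :: "'a::real_inner set"
  assumes cone: "\<And>r z. 0 \<le> r \<Longrightarrow> z \<in> K \<Longrightarrow> r *\<^sub>R z \<in> K"
    and pos: "\<And>z. z \<in> K \<Longrightarrow> z \<noteq> 0 \<Longrightarrow> 0 < d \<bullet> z" and \<eta>: "0 < \<eta>"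
    and e: "e extreme_point_of (K \<inter> {z. d \<bullet> z = \<eta>})"
  shows "{r *\<^sub>R e | r. 0 \<le> r} face_of K"
proof -
  let ?R = "{r *\<^sub>R e | r. 0 \<le> r}"
  have eK: "e \<in> K" "d \<bullet> e = \<eta>" using e by (auto simp: extreme_point_of_def)
  have ray: "r *\<^sub>R e \<in> ?R" if "0 \<le> r" for r using that by blast
  have ray0: "0 \<in> ?R" using ray[of 0] by simp
  have "convex ?R"
  proof (rule convexI)
    fix x y and u v :: real
    assume xy: "x \<in> ?R" "y \<in> ?R" and uv: "0 \<le> u" "0 \<le> v"
    obtain r r' where "0 \<le> r" "x = r *\<^sub>R e" "0 \<le> r'" "y = r' *\<^sub>R e" using xy by blast
    then have "u *\<^sub>R x + v *\<^sub>R y = (u * r + v * r') *\<^sub>R e" "0 \<le> u * r + v * r'"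
      using uv by (simp_all add: scaleR_left_distrib)
    then show "u *\<^sub>R x + v *\<^sub>R y \<in> ?R" by blast
  qed
  moreover have "a \<in> ?R \<and> b \<in> ?R" if a: "a \<in> K" "b \<in> K" "x \<in> ?R" "x \<in> open_segment a b" for a b x
  proof -
    obtain r where r: "0 \<le> r" "x = r *\<^sub>R e" using a(3) by blast
    obtain u where u: "0 < u" "u < 1" "x = (1 - u) *\<^sub>R a + u *\<^sub>R b"
      using a(4) by (auto simp: in_segment)
    consider "a = 0" | "b = 0" | "a \<noteq> 0" "b \<noteq> 0" by blast
    then show ?thesis
    proof cases
      case 1
      then have "(1 / u) *\<^sub>R (u *\<^sub>R b) = (1 / u) *\<^sub>R (r *\<^sub>R e)" using r u by simp
      then have "b = (r / u) *\<^sub>R e" using u by simp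
      then show ?thesis using 1 r u ray0 ray[of "r / u"] by simp
    next
      case 2
      then have "(1 / (1 - u)) *\<^sub>R ((1 - u) *\<^sub>R a) = (1 / (1 - u)) *\<^sub>R (r *\<^sub>R e)" using r u by simp
      then have "a = (r / (1 - u)) *\<^sub>R e" using u by simp
      then show ?thesis using 2 r u ray0 ray[of "r / (1 - u)"] by simp
    next
      case 3
      define A B where "A = d \<bullet> a / \<eta>" and "B = d \<bullet> b / \<eta>"
      have AB: "0 < A" "0 < B" using 3 a pos \<eta> by (auto simp: A_def B_def)
      define a' b' where "a' = (1 / A) *\<^sub>R a" and "b' = (1 / B) *\<^sub>R b"
      have a': "a = A *\<^sub>R a'" "b = B *\<^sub>R b'" using AB by (auto simp: a'_def b'_def)
      have mem: "a' \<in> K \<inter> {z. d \<bullet> z = \<eta>}" "b' \<in> K \<inter> {z. d \<bullet> z = \<eta>}"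
      proof -
        have "d \<bullet> a' = \<eta>" "d \<bullet> b' = \<eta>"
          using AB \<eta> by (auto simp: a'_def b'_def A_def B_def)
        moreover have "a' \<in> K" "b' \<in> K"
          using cone[of "1 / A" a] cone[of "1 / B" b] a AB by (auto simp: a'_def b'_def)
        ultimately show "a' \<in> K \<inter> {z. d \<bullet> z = \<eta>}" "b' \<in> K \<inter> {z. d \<bullet> z = \<eta>}" by auto
      qed
      have "d \<bullet> x = r * \<eta>" using r eK by simp
      then have r_eq: "r = (1 - u) * A + u * B"
      proof -
        have "d \<bullet> x = ((1 - u) * A + u * B) * \<eta>"
          using mem by (simp add: u(3) a' inner_add_right distrib_right)
        with \<open>d \<bullet> x = r * \<eta>\<close> show ?thesis using \<eta> by simp
      qed
      then have r_pos: "0 < r" using u AB by (simp add: add_pos_pos)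
      \<comment> \<open>The weight of \<open>b'\<close> after rescaling to the slice.\<close>
      define w where "w = u * B / r"
      have "0 < (1 - u) * A" "0 < u * B" using u AB by simp_all
      then have w: "0 < w" "w < 1" using r_pos r_eq by (simp_all add: w_def)
      have rw: "r * w = u * B" "r * (1 - w) = (1 - u) * A"
        using r_pos by (simp_all add: w_def right_diff_distrib) (simp add: r_eq)
      have "r *\<^sub>R e = r *\<^sub>R ((1 - w) *\<^sub>R a' + w *\<^sub>R b')"
        unfolding r(2)[symmetric] u(3) scaleR_add_right scaleR_scaleR rw a' by simp
      then have "e = (1 - w) *\<^sub>R a' + w *\<^sub>R b'" using r_pos by simp
      then have "a' = b' \<and> e = a' \<or> e \<in> open_segment a' b'"
        using w by (auto simp: in_segment algebra_simps)
      then have "a' = e" "b' = e"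
        using e mem by (auto simp: extreme_point_of_def)
      then show ?thesis using a' AB ray[of A] ray[of B] by simp
    qed
  qed
  ultimately show ?thesis
    using cone eK unfolding face_of_def by blast
qed

locale positive_recourse =
  fixes W :: "real ^ 'm ^ 's" and q :: "real ^ 'm"
  assumes complete: "\<forall>t. \<exists>y. (\<forall>j. 0 \<le> y $ j) \<and> W *v y = t"
    and positive: "\<forall>j. 0 < q $ j"
begin

abbreviation "\<phi> \<equiv> recourse_value W q"

lemma cost_nonneg: "(\<And>j. 0 \<le> y $ j) \<Longrightarrow> 0 \<le> q \<bullet> y"
  using positive unfolding inner_vec_def
  by (intro sum_nonneg) (simp add: less_imp_le)

lemma recourse_value_le:
  assumes "W *v y = t" "\<And>j. 0 \<le> y $ j"
  shows "\<phi> t \<le> q \<bullet> y"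
  unfolding recourse_value_def
proof (rule cInf_lower)
  show "bdd_below {q \<bullet> y |y. W *v y = t \<and> (\<forall>j. 0 \<le> y $ j)}"
    using cost_nonneg by (intro bdd_belowI[of _ 0]) auto
qed (use assms in auto)

lemma recourse_value_ge:
  assumes "\<And>y. W *v y = t \<Longrightarrow> (\<And>j. 0 \<le> y $ j) \<Longrightarrow> m \<le> q \<bullet> y"
  shows "m \<le> \<phi> t"
  unfolding recourse_value_def
  by (rule cInf_greatest) (use assms complete in blast)+

lemma nonneg: "0 \<le> \<phi> t"
  by (rule recourse_value_ge) (rule cost_nonneg)

lemma homogeneous:
  assumes "0 \<le> r"
  shows "\<phi> (r *\<^sub>R t) = r * \<phi> t"
proof (cases "r = 0")
  case True
  have "\<phi> 0 \<le> 0" using recourse_value_le[of 0 0] by simp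
  with True nonneg[of 0] show ?thesis by simp
next
  case False
  have le: "r * \<phi> t \<le> \<phi> (r *\<^sub>R t)" if "0 < r" for r t
  proof (rule recourse_value_ge)
    fix y assume y: "W *v y = r *\<^sub>R t" "\<And>j. 0 \<le> y $ j"
    have "\<phi> t \<le> q \<bullet> ((1 / r) *\<^sub>R y)"
      using y that by (intro recourse_value_le) (auto simp: matrix_vector_mult_scaleR)
    then show "r * \<phi> t \<le> q \<bullet> y" using that by (simp add: field_simps)
  qed
  have "0 < r" using assms False by simp
  then show ?thesis
    using le[of r t] le[of "1 / r" "r *\<^sub>R t"] by (simp add: field_simps)
qed

lemma subadditive: "\<phi> (s + t) \<le> \<phi> s + \<phi> t"
proof -
  have "\<phi> (s + t) - \<phi> t \<le> \<phi> s"
  proof (rule recourse_value_ge)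
    fix y assume y: "W *v y = s" "\<And>j. 0 \<le> y $ j"
    have "\<phi> (s + t) - q \<bullet> y \<le> \<phi> t"
    proof (rule recourse_value_ge)
      fix y' assume y': "W *v y' = t" "\<And>j. 0 \<le> y' $ j"
      have "\<phi> (s + t) \<le> q \<bullet> (y + y')"
        using y y' by (intro recourse_value_le) (auto simp: matrix_vector_right_distrib)
      then show "\<phi> (s + t) - q \<bullet> y \<le> q \<bullet> y'" by (simp add: inner_add_right)
    qed
    then show "\<phi> (s + t) - \<phi> t \<le> q \<bullet> y" by simp
  qed
  then show ?thesis by simp
qed

text \<open>
  One direction is weak duality; the other tests the inequality on the columns of \<open>W\<close>.
\<close>

lemma dual_feasible_iff: "v \<in> dual_feasible_set W q \<longleftrightarrow> (\<forall>t. v \<bullet> t \<le> \<phi> t)"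
proof
  assume v: "v \<in> dual_feasible_set W q"
  have "v \<bullet> t \<le> \<phi> t" for t
  proof (rule recourse_value_ge)
    fix y assume y: "W *v y = t" "\<And>j. 0 \<le> y $ j"
    have "v \<bullet> t = (transpose W *v v) \<bullet> y"
      using y by (simp add: dot_lmul_matrix)
    also have "\<dots> \<le> q \<bullet> y"
      using v y unfolding inner_vec_def
      by (intro sum_mono) (auto simp: dual_feasible_set_def intro: mult_right_mono)
    finally show "v \<bullet> t \<le> q \<bullet> y" .
  qed
  then show "\<forall>t. v \<bullet> t \<le> \<phi> t" by blast
next
  assume v: "\<forall>t. v \<bullet> t \<le> \<phi> t"
  have "(transpose W *v v) $ j \<le> q $ j" for j
  proof -
    have "(transpose W *v v) $ j = (transpose W *v v) \<bullet> axis j 1"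
      by (simp add: inner_axis)
    also have "\<dots> = v \<bullet> (W *v axis j 1)" by (simp add: dot_lmul_matrix)
    also have "\<dots> \<le> \<phi> (W *v axis j 1)" using v by blast
    also have "\<dots> \<le> q \<bullet> axis j 1"
      by (rule recourse_value_le) (auto simp: axis_def)
    finally show ?thesis by (simp add: inner_axis)
  qed
  then show "v \<in> dual_feasible_set W q" by (simp add: dual_feasible_set_def)
qed

lemma polyhedron_dual_feasible_set: "polyhedron (dual_feasible_set W q)"
proof -
  have "dual_feasible_set W q = (\<Inter>j. {v. (transpose W $ j) \<bullet> v \<le> q $ j})"
    unfolding dual_feasible_set_def matrix_vector_mul_component by auto
  also have "polyhedron \<dots>"
    by (intro polyhedron_Inter) (auto simp: polyhedron_halfspace_le)
  finally show ?thesis .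
qed

lemma compact_dual_feasible_set: "compact (dual_feasible_set W q)"
proof -
  have "norm v \<le> (\<Sum>i\<in>UNIV. \<phi> (axis i 1) + \<phi> (axis i (- 1)))" if "v \<in> dual_feasible_set W q" for v
  proof -
    have "\<bar>v $ i\<bar> \<le> \<phi> (axis i 1) + \<phi> (axis i (- 1))" for i
    proof -
      have "v \<bullet> axis i 1 \<le> \<phi> (axis i 1)" "v \<bullet> axis i (- 1) \<le> \<phi> (axis i (- 1))"
        using that dual_feasible_iff by auto
      then show ?thesis
        using nonneg[of "axis i 1"] nonneg[of "axis i (- 1)"] by (auto simp: inner_axis abs_if)
    qed
    then show ?thesis
      using norm_le_l1_cart[of v] by (meson order_trans sum_mono)
  qed
  then have "bounded (dual_feasible_set W q)"
    by (auto simp: bounded_iff)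
  with polyhedron_imp_closed[OF polyhedron_dual_feasible_set] show ?thesis
    by (simp add: compact_eq_bounded_closed)
qed

lemma finite_dual_vertices: "finite (dual_vertices W q)"
  unfolding dual_vertices_def
  by (rule finite_polyhedron_extreme_points[OF polyhedron_dual_feasible_set])

lemma vertex_le: "d \<in> dual_vertices W q \<Longrightarrow> d \<bullet> t \<le> \<phi> t"
  using dual_feasible_iff by (auto simp: dual_vertices_def extreme_point_of_def)

text \<open>
  Strong duality: a subgradient of \<open>\<phi>\<close> at \<open>t\<close> is dual feasible, and the dual polytope is the convex hull of its
  vertices.
\<close>

lemma max_attained_at_vertex: "\<exists>d\<in>dual_vertices W q. \<phi> t = d \<bullet> t"
proof (rule ccontr)
  assume "\<not> ?thesis"
  then have "dual_vertices W q \<subseteq> {v. t \<bullet> v < \<phi> t}"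
    using vertex_le[of _ t] by (force simp: inner_commute)
  then have "convex hull dual_vertices W q \<subseteq> {v. t \<bullet> v < \<phi> t}"
    by (intro hull_minimal convex_halfspace_lt)
  moreover have "convex hull dual_vertices W q = dual_feasible_set W q"
    unfolding dual_vertices_def
    using Krein_Milman_Minkowski[OF compact_dual_feasible_set polyhedron_imp_convex[OF polyhedron_dual_feasible_set]]
    by simp
  moreover obtain v where "v \<bullet> t = \<phi> t" "\<And>x. v \<bullet> x \<le> \<phi> x"
    using sublinear_support[of \<phi>] homogeneous subadditive by blast
  ultimately show False
    using dual_feasible_iff[of v] by (auto simp: inner_commute)
qed

lemma coercive_convex_recourse_value: "\<exists>c L. coercive_convex \<phi> c L"
proof -
  obtain L where L: "\<And>v. v \<in> dual_feasible_set W q \<Longrightarrow> norm v \<le> L"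
    using compact_imp_bounded[OF compact_dual_feasible_set] by (auto simp: bounded_iff)
  have up: "\<phi> t \<le> L * norm t" for t
  proof -
    obtain d where d: "d \<in> dual_vertices W q" "\<phi> t = d \<bullet> t" using max_attained_at_vertex by blast
    have "norm d \<le> L" using d L by (auto simp: dual_vertices_def extreme_point_of_def)
    then show ?thesis
      using norm_cauchy_schwarz[of d t] d mult_right_mono[of "norm d" L "norm t"] by simp
  qed
  have "open (\<Inter>j. {v. (transpose W $ j) \<bullet> v < q $ j})"
    by (intro open_INT) (auto simp: open_halfspace_lt)
  moreover have "0 \<in> (\<Inter>j. {v. (transpose W $ j) \<bullet> v < q $ j})"
    using positive by simp
  ultimately obtain e where e: "0 < e" "cball 0 e \<subseteq> (\<Inter>j. {v. (transpose W $ j) \<bullet> v < q $ j})"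
    using open_contains_cball by blast
  have low: "e * norm t \<le> \<phi> t" for t
  proof -
    have "e *\<^sub>R sgn t \<in> cball 0 e" using e by (simp add: norm_sgn)
    then have "(transpose W $ j) \<bullet> (e *\<^sub>R sgn t) < q $ j" for j
      using e(2) by blast
    then have "e *\<^sub>R sgn t \<in> dual_feasible_set W q"
      unfolding dual_feasible_set_def matrix_vector_mul_component by (blast intro: less_imp_le)
    then have "(e *\<^sub>R sgn t) \<bullet> t \<le> \<phi> t" using dual_feasible_iff by blast
    then show ?thesis
      by (cases "t = 0") (simp_all add: sgn_div_norm dot_square_norm power2_eq_square field_simps)
  qed
  have "coercive_convex \<phi> e L"
  proof
    show "convex_on UNIV \<phi>"
    proof (rule convex_onI)
      show "\<phi> ((1 - u) *\<^sub>R x + u *\<^sub>R y) \<le> (1 - u) * \<phi> x + u * \<phi> y" if "0 < u" "u < 1" for u x y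
        using subadditive[of "(1 - u) *\<^sub>R x" "u *\<^sub>R y"] homogeneous that by simp
    qed simp
    show "\<phi> s - \<phi> t \<le> L * norm (s - t)" for s t
      using subadditive[of "s - t" t] up[of "s - t"] by simp
    show "\<phi> 0 = 0" using homogeneous[of 0 0] by simp
  qed (use e low in auto)
  then show ?thesis by blast
qed

lemma recourse_value_pos: "t \<noteq> 0 \<Longrightarrow> 0 < \<phi> t"
proof -
  assume t: "t \<noteq> 0"
  obtain c L where "coercive_convex \<phi> c L" using coercive_convex_recourse_value by blast
  then interpret coercive_convex \<phi> c L .
  have "0 < c * norm t" using c_pos t by simp
  with coercive[of t] show ?thesis by simp
qed

lemma vertex_cone_eq:
  assumes "d \<in> dual_vertices W q"
  shows "vertex_cone W q d = {z. \<phi> z = d \<bullet> z}"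
proof (intro set_eqI iffI)
  fix z assume z: "z \<in> vertex_cone W q d"
  obtain d' where "d' \<in> dual_vertices W q" "\<phi> z = d' \<bullet> z" using max_attained_at_vertex by blast
  with z have "\<phi> z \<le> d \<bullet> z" by (auto simp: vertex_cone_def inner_diff_left)
  with vertex_le[OF assms, of z] show "z \<in> {z. \<phi> z = d \<bullet> z}" by simp
next
  fix z assume "z \<in> {z. \<phi> z = d \<bullet> z}"
  then show "z \<in> vertex_cone W q d"
    using vertex_le[of _ z] by (auto simp: vertex_cone_def inner_diff_left)
qed

lemma polyhedron_vertex_cone: "polyhedron (vertex_cone W q d)"
proof -
  have "vertex_cone W q d = (\<Inter>d'\<in>dual_vertices W q. {z. (d - d') \<bullet> z \<ge> 0})"
    by (auto simp: vertex_cone_def)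
  also have "polyhedron \<dots>"
    using finite_dual_vertices by (intro polyhedron_Inter) (auto simp: polyhedron_halfspace_ge)
  finally show ?thesis .
qed

lemma interior_vertex_cone_nonempty_iff:
  assumes "d \<in> dual_vertices W q"
  shows "d \<in> plus_vertices W q \<longleftrightarrow> interior (vertex_cone W q d) \<noteq> {}"
proof -
  have "vertex_cone_plus W q d = vertex_cone W q d"
    unfolding vertex_cone_plus_def vertex_cone_eq[OF assms] using nonneg
    by (auto; metis)
  moreover have "interior (vertex_cone W q d) = {}" if "d = 0"
  proof -
    have "vertex_cone W q d \<subseteq> {0}"
    proof
      fix z assume "z \<in> vertex_cone W q d"
      then have "\<phi> z = 0" unfolding vertex_cone_eq[OF assms] using that by simp
      then show "z \<in> {0}" using recourse_value_pos[of z] by auto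
    qed
    then have "interior (vertex_cone W q d) \<subseteq> interior {0}" by (rule interior_mono)
    then show ?thesis by simp
  qed
  ultimately show ?thesis using assms by (auto simp: plus_vertices_def)
qed

text \<open>
  The finitely many closed cones of the other vertices have empty interior, so their union is nowhere dense; the remaining
  cones have a closed union and therefore cover the whole space.
\<close>

lemma max_attained_at_plus_vertex: "\<exists>d\<in>plus_vertices W q. \<phi> t = d \<bullet> t"
proof -
  let ?C = "vertex_cone W q"
  let ?P = "plus_vertices W q" and ?N = "dual_vertices W q - plus_vertices W q"
  have P: "?P \<subseteq> dual_vertices W q" by (auto simp: plus_vertices_def)
  have "UNIV = \<Union>(?C ` ?P) \<union> \<Union>(?C ` ?N)"
  proof (intro subset_antisym subsetI)
    fix z
    obtain d where "d \<in> dual_vertices W q" "z \<in> ?C d"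
      using max_attained_at_vertex[of z] vertex_cone_eq by auto
    then show "z \<in> \<Union>(?C ` ?P) \<union> \<Union>(?C ` ?N)" by (cases "d \<in> ?P") auto
  qed simp
  moreover have "interior (\<Union>(?C ` ?N)) = {}"
    using finite_dual_vertices interior_vertex_cone_nonempty_iff polyhedron_imp_closed[OF polyhedron_vertex_cone]
    by (intro interior_Union_closed_empty) auto
  moreover have "closed (\<Union>(?C ` ?P))"
    using finite_subset[OF P finite_dual_vertices] polyhedron_imp_closed[OF polyhedron_vertex_cone]
    by (intro closed_UN) auto
  ultimately have "interior (\<Union>(?C ` ?P)) = UNIV"
    using interior_closed_Un_empty_interior[of "\<Union>(?C ` ?P)" "\<Union>(?C ` ?N)"] by simp
  then have "t \<in> \<Union>(?C ` ?P)" using interior_subset by blast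
  then obtain d where "d \<in> ?P" "t \<in> ?C d" by blast
  then show ?thesis using vertex_cone_eq P by auto
qed

text \<open>
  \<^const>\<open>arg_min\<close> is meaningful only if the minimum exists. The candidates are finitely many because a polyhedral cone has
  finitely many faces. There is at least one because the slice of the cone at height \<open>\<eta>\<close> is compact by coercivity, hence
  has an extreme point, and that point spans an extreme ray.
\<close>

lemma min_norm_ray_point_mem:
  assumes d: "d \<in> plus_vertices W q" and \<eta>: "0 < \<eta>"
  shows "min_norm_ray_point W q d \<eta> \<in> ray_hyperplane_points W q d \<eta>"
proof -
  let ?K = "vertex_cone W q d" and ?H = "{z. d \<bullet> z = \<eta>}"
  have dv: "d \<in> dual_vertices W q" using d by (simp add: plus_vertices_def)
  note K = vertex_cone_eq[OF dv]
  have pos: "0 < d \<bullet> z" if "z \<in> ?K" "z \<noteq> 0" for z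
    using that recourse_value_pos[of z] by (simp add: K)
  have cone: "r *\<^sub>R z \<in> ?K" if "0 \<le> r" "z \<in> ?K" for r z
    using that homogeneous[of r z] by (simp add: K)
  have "finite (ray_hyperplane_points W q d \<eta>)"
  proof (rule finite_subset)
    show "ray_hyperplane_points W q d \<eta> \<subseteq> (\<lambda>R. the_elem (R \<inter> ?H)) ` {R. R face_of ?K}"
      by (force simp: ray_hyperplane_points_def extreme_ray_of_def image_iff)
    show "finite ((\<lambda>R. the_elem (R \<inter> ?H)) ` {R. R face_of ?K})"
      using finite_polyhedron_faces[OF polyhedron_vertex_cone] by blast
  qed
  moreover have "ray_hyperplane_points W q d \<eta> \<noteq> {}"
  proof -
    have "closed ?K" "convex ?K"
      using polyhedron_imp_closed polyhedron_imp_convex polyhedron_vertex_cone by auto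
    obtain c L where "coercive_convex \<phi> c L" using coercive_convex_recourse_value by blast
    then interpret coercive_convex \<phi> c L .
    have "?K \<inter> ?H \<subseteq> cball 0 (\<eta> / c)"
    proof
      fix z assume "z \<in> ?K \<inter> ?H"
      then show "z \<in> cball 0 (\<eta> / c)" using coercive[of z] c_pos by (simp add: K field_simps)
    qed
    then have "bounded (?K \<inter> ?H)" by (rule bounded_subset[OF bounded_cball])
    moreover have "closed (?K \<inter> ?H)" using \<open>closed ?K\<close> by (intro closed_Int closed_hyperplane)
    ultimately have "compact (?K \<inter> ?H)" by (simp add: compact_eq_bounded_closed)
    moreover have "convex (?K \<inter> ?H)" using \<open>convex ?K\<close> by (intro convex_Int convex_hyperplane)
    moreover have "?K \<inter> ?H \<noteq> {}"
    proof -
      obtain z where "z \<in> interior ?K" "z \<noteq> 0"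
        using open_has_nonzero[OF open_interior] d interior_vertex_cone_nonempty_iff[OF dv] by blast
      then have z: "z \<in> ?K" "z \<noteq> 0" using interior_subset[of ?K] by auto
      then have "(\<eta> / (d \<bullet> z)) *\<^sub>R z \<in> ?K \<inter> ?H" using pos[OF z] cone[of "\<eta> / (d \<bullet> z)" z] \<eta> by auto
      then show ?thesis by blast
    qed
    ultimately obtain e where e: "e extreme_point_of (?K \<inter> ?H)"
      using extreme_point_exists_convex by blast
    have eH: "d \<bullet> e = \<eta>" using e by (auto simp: extreme_point_of_def)
    let ?R = "{r *\<^sub>R e | r. 0 \<le> r}"
    have "?R face_of ?K"
      using extreme_point_of_slice_spans_face[OF cone pos \<eta> e] by simp
    moreover have "e \<noteq> 0" using eH \<eta> by auto
    ultimately have "extreme_ray_of ?R ?K" unfolding extreme_ray_of_def by blast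
    moreover have "?R \<inter> ?H = {e}"
    proof (intro set_eqI iffI)
      fix z assume "z \<in> ?R \<inter> ?H"
      then obtain r where r: "z = r *\<^sub>R e" "d \<bullet> z = \<eta>" by blast
      then have "r = 1" using eH \<eta> by simp
      with r show "z \<in> {e}" by simp
    next
      fix z assume "z \<in> {e}"
      then have "z = 1 *\<^sub>R e" "d \<bullet> z = \<eta>" using eH by auto
      then show "z \<in> ?R \<inter> ?H" using zero_le_one by blast
    qed
    ultimately show ?thesis unfolding ray_hyperplane_points_def by blast
  qed
  ultimately obtain y where "is_arg_min norm (\<lambda>y. y \<in> ray_hyperplane_points W q d \<eta>) y"
    using ex_is_arg_min_if_finite by blast
  then have "is_arg_min norm (\<lambda>y. y \<in> ray_hyperplane_points W q d \<eta>) (min_norm_ray_point W q d \<eta>)"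
    unfolding min_norm_ray_point_def arg_min_def by (rule someI)
  then show ?thesis by (simp add: is_arg_min_def)
qed

text \<open>
  The intersection point with an extreme ray need not lie in the interior of the cone. Moving it slightly, within the
  hyperplane, towards an interior point of the cone keeps its norm below \<open>\<rho>\<close>.
\<close>

lemma window_on_level_set:
  assumes d: "d \<in> plus_vertices W q" and \<eta>: "0 < \<eta>"
    and near: "norm (min_norm_ray_point W q d \<eta>) < \<rho>"
  shows "\<exists>b R. 0 < R \<and> d \<bullet> b = \<eta> \<and> ball b R \<subseteq> ball 0 \<rho> \<inter> {t. \<phi> t = d \<bullet> t}"
proof -
  let ?K = "vertex_cone W q d"
  have dv: "d \<in> dual_vertices W q" using d by (simp add: plus_vertices_def)
  note K = vertex_cone_eq[OF dv]
  define y where "y = min_norm_ray_point W q d \<eta>"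
  have "y \<in> ray_hyperplane_points W q d \<eta>" unfolding y_def by (rule min_norm_ray_point_mem[OF d \<eta>])
  then obtain F where F: "F face_of ?K" "F \<inter> {z. d \<bullet> z = \<eta>} = {y}"
    unfolding ray_hyperplane_points_def extreme_ray_of_def by blast
  then have "y \<in> F \<inter> {z. d \<bullet> z = \<eta>}" by simp
  then have y: "y \<in> ?K" "d \<bullet> y = \<eta>"
    using face_of_imp_subset[OF F(1)] by auto
  obtain w where w: "w \<in> interior ?K" "w \<noteq> 0"
    using open_has_nonzero[OF open_interior] d interior_vertex_cone_nonempty_iff[OF dv] by blast
  then have dw: "0 < d \<bullet> w" using recourse_value_pos[of w] interior_subset[of ?K] by (auto simp: K)
  define g where "g = (\<lambda>u. (1 - u) *\<^sub>R y + u *\<^sub>R ((\<eta> / (d \<bullet> w)) *\<^sub>R w))"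
  have dg: "d \<bullet> g u = \<eta>" for u
    using dw y by (simp add: g_def inner_add_right algebra_simps)
  have "(g \<longlongrightarrow> g 0) (at_right 0)"
    unfolding g_def by (intro tendsto_intros)
  then have "\<forall>\<^sub>F u in at_right 0. g u \<in> ball 0 \<rho>"
    using near by (intro topological_tendstoD) (auto simp: g_def y_def)
  moreover have "\<forall>\<^sub>F u in at_right (0::real). u \<in> {0<..<1}"
    by (rule eventually_at_right_real) simp
  ultimately have "\<forall>\<^sub>F u in at_right (0::real). g u \<in> ball 0 \<rho> \<and> u \<in> {0<..<1}"
    by (rule eventually_conj)
  then obtain u where u: "g u \<in> ball 0 \<rho>" "0 < u" "u < 1"
    using eventually_happens[of _ "at_right (0::real)"] by auto
  have sw: "(\<eta> / (d \<bullet> w)) *\<^sub>R w \<in> interior ?K"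
  proof -
    let ?r = "\<eta> / (d \<bullet> w)"
    have r: "0 < ?r" using \<eta> dw by simp
    have "(*\<^sub>R) ?r ` interior ?K \<subseteq> ?K"
      using homogeneous[of ?r] r interior_subset[of ?K] by (auto simp: K)
    moreover have "open ((*\<^sub>R) ?r ` interior ?K)"
      using \<eta> dw by (intro open_scaling open_interior) simp
    ultimately have "(*\<^sub>R) ?r ` interior ?K \<subseteq> interior ?K" by (rule interior_maximal)
    then show ?thesis using w by blast
  qed
  have "g u \<in> interior ?K"
  proof -
    have "y - (1 - (1 - u)) *\<^sub>R (y - (\<eta> / (d \<bullet> w)) *\<^sub>R w) \<in> interior ?K"
      using u y sw polyhedron_imp_convex[OF polyhedron_vertex_cone]
      by (intro mem_interior_convex_shrink) auto
    then show ?thesis by (simp add: g_def algebra_simps)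
  qed
  with u have "g u \<in> ball 0 \<rho> \<inter> interior ?K" by simp
  then obtain R where "0 < R" "ball (g u) R \<subseteq> ball 0 \<rho> \<inter> interior ?K"
    using open_contains_ball[of "ball 0 \<rho> \<inter> interior ?K"] by (metis open_Int open_ball open_interior)
  then show ?thesis
    using dg interior_subset[of ?K] K by blast
qed

end

section \<open>Expected excess and conditional value at risk\<close>

text \<open>
  Only the part \<open>B\<close> of the mass, where the density is bounded below, is kept.
\<close>

lemma density_integral_ge:
  fixes \<theta> f :: "'a::euclidean_space \<Rightarrow> real"
  assumes \<theta>: "\<theta> \<in> borel_measurable borel" "\<forall>z. 0 \<le> \<theta> z"
    and f: "f \<in> borel_measurable borel" "\<And>z. 0 \<le> f z"
    and int: "integrable (density lborel (\<lambda>z. ennreal (\<theta> z))) f"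
    and B: "set_integrable lborel B f" "AE z in lborel. z \<in> B \<longrightarrow> r \<le> \<theta> z"
  shows "r * (LINT z:B|lborel. f z) \<le> (LINT z|density lborel (\<lambda>z. ennreal (\<theta> z)). f z)"
proof -
  have "integrable lborel (\<lambda>z. \<theta> z * f z)"
    using int \<theta> f by (subst (asm) integrable_real_density) auto
  moreover have "AE z in lborel. r * (indicator B z *\<^sub>R f z) \<le> \<theta> z * f z"
    using B(2)
  proof eventually_elim
    case (elim z)
    then show ?case using \<theta>(2) f(2) by (auto split: split_indicator intro: mult_right_mono)
  qed
  ultimately have "(LINT z|lborel. r * (indicator B z *\<^sub>R f z)) \<le> (LINT z|lborel. \<theta> z * f z)"
    using B(1) by (intro integral_mono_AE) (auto simp: set_integrable_def)
  also have "\<dots> = (LINT z|density lborel (\<lambda>z. ennreal (\<theta> z)). f z)"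
    using \<theta> f by (subst integral_real_density) auto
  finally show ?thesis by (simp add: set_lebesgue_integral_def)
qed

locale recourse_risk = positive_recourse W q + prob_space \<mu>
  for W :: "real ^ 'm ^ 's" and q :: "real ^ 'm" and \<mu> :: "(real ^ 's) measure" +
  assumes sets_\<mu>: "sets \<mu> = sets borel" and first_moment: "integrable \<mu> norm"
begin

abbreviation "Q \<equiv> Q_EE W q \<mu>"

lemma Q_eq: "Q x \<eta> = (LINT z|\<mu>. excess \<phi> (z - x, \<eta>))"
  by (simp add: Q_EE_def excess_def)

lemma convex_\<phi>: "convex_on UNIV \<phi>"
  using coercive_convex_recourse_value coercive_convex.convex by blast

lemma measurable_\<mu>: "f \<in> borel_measurable borel \<Longrightarrow> f \<in> borel_measurable \<mu>"
  using measurable_cong_sets[OF sets_\<mu> refl] by blast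

lemma continuous_\<phi>_shift: "continuous_on UNIV (\<lambda>z. \<phi> (z - x))"
  using convex_on_continuous[OF open_UNIV convex_\<phi>]
  by (rule continuous_on_compose2) (auto intro!: continuous_intros)

lemma measurable_\<phi>_shift: "(\<lambda>z. \<phi> (z - x)) \<in> borel_measurable \<mu>"
  by (intro measurable_\<mu> borel_measurable_continuous_onI continuous_\<phi>_shift)

lemma integrable_\<phi>_shift: "integrable \<mu> (\<lambda>z. \<phi> (z - x))"
proof -
  obtain c L where "coercive_convex \<phi> c L" using coercive_convex_recourse_value by blast
  then interpret coercive_convex \<phi> c L .
  have "\<bar>\<phi> (z - x)\<bar> \<le> \<bar>L * norm z + L * norm x\<bar>" for z
  proof -
    have "\<phi> (z - x) \<le> L * norm (z - x)" by (rule upper)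
    also have "\<dots> \<le> L * (norm z + norm x)"
      using L_pos norm_triangle_ineq4[of z x] by simp
    finally show ?thesis using nonneg[of "z - x"] by (simp add: distrib_left)
  qed
  then have "AE z in \<mu>. norm (\<phi> (z - x)) \<le> norm (L * norm z + L * norm x)"
    by (intro AE_I2) (simp only: real_norm_def)
  moreover have "integrable \<mu> (\<lambda>z. L * norm z + L * norm x)"
    by (intro Bochner_Integration.integrable_add integrable_mult_right first_moment) simp
  ultimately show ?thesis
    by (intro Bochner_Integration.integrable_bound[OF _ measurable_\<phi>_shift])
qed

lemma integrable_excess: "integrable \<mu> (\<lambda>z. excess \<phi> (z - x, \<eta>))"
  unfolding excess_def prod.case
  using integrable_\<phi>_shift by (intro integrable_max) auto

lemma Q_nonneg: "0 \<le> Q x \<eta>"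
  unfolding Q_EE_def by (intro Bochner_Integration.integral_nonneg) simp

lemma Q_ge_neg_level: "- \<eta> \<le> Q x \<eta>"
proof -
  have "(LINT z|\<mu>. - \<eta>) \<le> Q x \<eta>"
    unfolding Q_eq
  proof (rule integral_mono)
    show "- \<eta> \<le> excess \<phi> (z - x, \<eta>)" for z
      using nonneg[of "z - x"] by (simp add: excess_def)
  qed (auto intro: integrable_excess)
  then show ?thesis by (simp add: prob_space)
qed

text \<open>
  The slope of \<open>Q x\<close> as a function of the level is, up to sign, the probability of exceeding it.
\<close>

lemma Q_level_le: "\<eta> \<le> t \<Longrightarrow> Q x \<eta> \<le> Q x t + (t - \<eta>) * measure \<mu> {z. \<eta> < \<phi> (z - x)}"
proof -
  assume t: "\<eta> \<le> t"
  have meas: "{z. \<eta> < \<phi> (z - x)} \<in> sets \<mu>"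
    using measurable_\<phi>_shift[of x] sets_eq_imp_space_eq[OF sets_\<mu>]
    by (simp add: borel_measurable_iff_greater)
  have "Q x \<eta> \<le> (LINT z|\<mu>. excess \<phi> (z - x, t) + (t - \<eta>) * indicator {z. \<eta> < \<phi> (z - x)} z)"
    unfolding Q_eq
  proof (rule integral_mono)
    show "integrable \<mu> (\<lambda>z. excess \<phi> (z - x, t) + (t - \<eta>) * indicator {z. \<eta> < \<phi> (z - x)} z)"
      using meas integrable_excess by (auto simp: emeasure_eq_measure)
    show "excess \<phi> (z - x, \<eta>) \<le> excess \<phi> (z - x, t) + (t - \<eta>) * indicator {z. \<eta> < \<phi> (z - x)} z" for z
      using t by (auto simp: excess_def split: split_indicator)
  qed (rule integrable_excess)
  also have "\<dots> = Q x t + (t - \<eta>) * measure \<mu> {z. \<eta> < \<phi> (z - x)}"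
    using meas integrable_excess by (simp add: Q_eq emeasure_eq_measure)
  finally show ?thesis .
qed

lemma measure_above_level: "measure \<mu> {z. \<eta> < \<phi> (z - x)} = 1 - measure \<mu> {z. \<phi> (z - x) \<le> \<eta>}"
proof -
  have sp: "space \<mu> = UNIV" using sets_eq_imp_space_eq[OF sets_\<mu>] by simp
  have "{z. \<phi> (z - x) \<le> \<eta>} \<in> sets \<mu>"
    using measurable_\<phi>_shift[of x] sp by (simp add: borel_measurable_iff_le)
  then have "measure \<mu> (space \<mu> - {z. \<phi> (z - x) \<le> \<eta>}) = 1 - measure \<mu> {z. \<phi> (z - x) \<le> \<eta>}"
    by (rule prob_compl)
  moreover have "space \<mu> - {z. \<phi> (z - x) \<le> \<eta>} = {z. \<eta> < \<phi> (z - x)}" by (auto simp: sp)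
  ultimately show ?thesis by simp
qed

text \<open>
  The set whose infimum is the value at risk is nonempty, by Markov's inequality. Without this, the default value
  of the infimum of the empty set would carry no information.
\<close>

lemma VaR_level_exists:
  assumes "0 < \<alpha>"
  shows "\<exists>t. 1 - \<alpha> \<le> measure \<mu> {z. \<phi> (z - x) \<le> t}"
proof -
  define E where "E = (LINT z|\<mu>. \<phi> (z - x))"
  have E: "0 \<le> E" unfolding E_def using nonneg by (intro Bochner_Integration.integral_nonneg)
  define t where "t = E / \<alpha> + 1"
  have t: "0 < t" "E \<le> \<alpha> * t" using E assms by (auto simp: t_def field_simps add_nonneg_pos)
  have sp: "space \<mu> = UNIV" using sets_eq_imp_space_eq[OF sets_\<mu>] by simp
  have "measure \<mu> {z. t < \<phi> (z - x)} \<le> measure \<mu> {z \<in> space \<mu>. t \<le> \<phi> (z - x)}"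
    using measurable_\<phi>_shift[of x] by (intro finite_measure_mono) (auto simp: borel_measurable_iff_ge sp)
  also have "\<dots> \<le> E / t"
    unfolding E_def using t nonneg
    by (intro integral_Markov_inequality_measure[where A = "{}"] integrable_\<phi>_shift) auto
  also have "\<dots> \<le> \<alpha>" using t by (simp add: field_simps)
  finally show ?thesis by (auto simp: measure_above_level intro!: exI[of _ t])
qed

lemma CVaR_objective_nonneg:
  assumes "0 < \<alpha>" "\<alpha> < 1"
  shows "0 \<le> \<eta> + 1 / \<alpha> * Q x \<eta>"
proof -
  have "Q x \<eta> \<le> 1 / \<alpha> * Q x \<eta>"
    using assms Q_nonneg[of x \<eta>] by (simp add: field_simps mult_left_le_one_le)
  with Q_ge_neg_level[of \<eta> x] show ?thesis by simp
qed

text \<open>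
  The value at risk is an infimum that is approximated by levels \<open>s\<close> with exceedance probability at most \<open>\<alpha>\<close>. Above such a
  level \<open>Q x\<close> falls with slope at most \<open>\<alpha>\<close>, which the term \<open>\<eta>\<close> compensates; on the short stretch below it the
  slope is at most \<open>1\<close>.
\<close>

lemma CVaR_objective_increasing_above_VaR:
  assumes \<alpha>: "0 < \<alpha>" and VaR: "Q_VaR W q \<mu> \<alpha> x \<le> \<eta>\<^sub>0" and \<eta>: "\<eta>\<^sub>0 \<le> \<eta>"
  shows "\<eta>\<^sub>0 + 1 / \<alpha> * Q x \<eta>\<^sub>0 \<le> \<eta> + 1 / \<alpha> * Q x \<eta>"
proof (rule field_le_epsilon)
  fix e :: real assume e: "0 < e"
  let ?S = "{t. 1 - \<alpha> \<le> measure \<mu> {z. \<phi> (z - x) \<le> t}}"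
  have "0 < e * \<alpha>" using e \<alpha> by simp
  then have "Inf ?S < \<eta>\<^sub>0 + e * \<alpha>" using VaR unfolding Q_VaR_def by linarith
  moreover have "?S \<noteq> {}" using VaR_level_exists[OF \<alpha>] by blast
  ultimately have "\<exists>s\<in>?S. s < \<eta>\<^sub>0 + e * \<alpha>" by (intro cInf_lessD)
  then obtain s where s: "s \<in> ?S" "s < \<eta>\<^sub>0 + e * \<alpha>" by (elim bexE)
  define t where "t = max s \<eta>\<^sub>0"
  have t: "\<eta>\<^sub>0 \<le> t" "t \<le> \<eta>\<^sub>0 + e * \<alpha>" using s e \<alpha> by (auto simp: t_def)
  have "{z. \<phi> (z - x) \<le> t} \<in> sets \<mu>"
    using measurable_\<phi>_shift[of x] sets_eq_imp_space_eq[OF sets_\<mu>] by (simp add: borel_measurable_iff_le)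
  then have "measure \<mu> {z. \<phi> (z - x) \<le> s} \<le> measure \<mu> {z. \<phi> (z - x) \<le> t}"
    by (intro finite_measure_mono) (auto simp: t_def)
  then have tS: "measure \<mu> {z. t < \<phi> (z - x)} \<le> \<alpha>"
    using s(1) by (simp add: measure_above_level)
  have "Q x \<eta>\<^sub>0 \<le> Q x \<eta> + \<alpha> * (\<eta> - \<eta>\<^sub>0) + e * \<alpha>"
  proof (cases "\<eta> \<le> t")
    case True
    have "(\<eta> - \<eta>\<^sub>0) * measure \<mu> {z. \<eta>\<^sub>0 < \<phi> (z - x)} \<le> (\<eta> - \<eta>\<^sub>0) * 1"
      using \<eta> by (intro mult_left_mono prob_le_1) auto
    moreover have "0 \<le> \<alpha> * (\<eta> - \<eta>\<^sub>0)" using \<alpha> \<eta> by simp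
    ultimately show ?thesis using Q_level_le[OF \<eta>, of x] True t by simp
  next
    case False
    then have t\<eta>: "t \<le> \<eta>" by simp
    have "(t - \<eta>\<^sub>0) * measure \<mu> {z. \<eta>\<^sub>0 < \<phi> (z - x)} \<le> t - \<eta>\<^sub>0"
      using t by (intro mult_left_le prob_le_1) auto
    moreover have "(\<eta> - t) * measure \<mu> {z. t < \<phi> (z - x)} \<le> (\<eta> - \<eta>\<^sub>0) * \<alpha>"
      using t\<eta> t tS by (intro mult_mono) auto
    then have "(\<eta> - t) * measure \<mu> {z. t < \<phi> (z - x)} \<le> \<alpha> * (\<eta> - \<eta>\<^sub>0)"
      by (simp only: mult.commute)
    ultimately show ?thesis
      using Q_level_le[OF t(1), of x] Q_level_le[OF t\<eta>, of x] t by linarith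
  qed
  then have "1 / \<alpha> * Q x \<eta>\<^sub>0 \<le> 1 / \<alpha> * (Q x \<eta> + \<alpha> * (\<eta> - \<eta>\<^sub>0) + e * \<alpha>)"
    using \<alpha> by (intro mult_left_mono) auto
  then show "\<eta>\<^sub>0 + 1 / \<alpha> * Q x \<eta>\<^sub>0 \<le> \<eta> + 1 / \<alpha> * Q x \<eta> + e"
    using \<alpha> by (simp add: add_divide_distrib)
qed

text \<open>
  Near-optimal levels for \<open>x\<close> and \<open>y\<close> may be taken at most \<open>\<eta>\<^sub>0\<close>; their convex combination is a competitor at the
  intermediate point, and there the partial strong convexity of \<open>Q\<close> applies.
\<close>

lemma strongly_convex_CVaR:
  assumes \<alpha>: "0 < \<alpha>" "\<alpha> < 1"
    and VaR: "\<And>x. x \<in> V \<Longrightarrow> Q_VaR W q \<mu> \<alpha> x \<le> \<eta>\<^sub>0"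
    and psc: "partially_strongly_convex_on \<kappa> V {..\<eta>\<^sub>0} Q"
  shows "strongly_convex_on (\<kappa> / \<alpha>) V (Q_CVaR W q \<mu> \<alpha>)"
  unfolding strongly_convex_on_def
proof (intro conjI ballI)
  let ?C = "Q_CVaR W q \<mu> \<alpha>"
  show cV: "convex V" using psc by (simp add: partially_strongly_convex_on_def)
  define F where "F = (\<lambda>x \<eta>. \<eta> + 1 / \<alpha> * Q x \<eta>)"
  have C: "?C x = (INF \<eta>. F x \<eta>)" for x by (simp add: Q_CVaR_def F_def)
  have bdd: "bdd_below (range (F x))" for x
    using CVaR_objective_nonneg[OF \<alpha>] by (intro bdd_belowI[of _ 0]) (auto simp: F_def)
  have near: "\<exists>\<eta>\<le>\<eta>\<^sub>0. F x \<eta> \<le> ?C x + e" if "x \<in> V" "0 < e" for x e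
  proof -
    have "(INF \<eta>. F x \<eta>) < ?C x + e" using that by (simp add: C)
    then obtain \<eta> where \<eta>: "F x \<eta> < ?C x + e" using cInf_lessD[of "range (F x)"] by auto
    have "F x (min \<eta> \<eta>\<^sub>0) \<le> F x \<eta>"
      using CVaR_objective_increasing_above_VaR[OF \<alpha>(1) VaR[OF that(1)], of \<eta>]
      by (cases "\<eta> \<le> \<eta>\<^sub>0") (auto simp: F_def min_def)
    with \<eta> show ?thesis by (intro exI[of _ "min \<eta> \<eta>\<^sub>0"]) auto
  qed
  fix x y and u :: real
  assume x: "x \<in> V" and y: "y \<in> V" and u: "u \<in> {0<..<1}"
  let ?z = "u *\<^sub>R x + (1 - u) *\<^sub>R y"
  let ?m = "\<kappa> / 2 * u * (1 - u) * (norm (x - y))\<^sup>2"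
  show "?C ?z \<le> u * ?C x + (1 - u) * ?C y - \<kappa> / \<alpha> / 2 * u * (1 - u) * (norm (x - y))\<^sup>2"
  proof (rule field_le_epsilon)
    fix e :: real assume e: "0 < e"
    obtain a b where a: "a \<le> \<eta>\<^sub>0" "F x a \<le> ?C x + e" and b: "b \<le> \<eta>\<^sub>0" "F y b \<le> ?C y + e"
      using near[OF x e] near[OF y e] by blast
    have "?C ?z \<le> F ?z (u * a + (1 - u) * b)"
      unfolding C by (rule cINF_lower[OF bdd]) simp
    also have "Q ?z (u * a + (1 - u) * b) \<le> u * Q x a + (1 - u) * Q y b - ?m"
      using psc x y u a b unfolding partially_strongly_convex_on_def
      by (metis atMost_iff real_scaleR_def)
    then have "F ?z (u * a + (1 - u) * b)
      \<le> u * a + (1 - u) * b + 1 / \<alpha> * (u * Q x a + (1 - u) * Q y b - ?m)"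
      unfolding F_def using \<alpha> by (intro add_left_mono mult_left_mono) auto
    also have "\<dots> = u * F x a + (1 - u) * F y b - 1 / \<alpha> * ?m"
      by (simp add: F_def algebra_simps diff_divide_distrib add_divide_distrib)
    also have "\<dots> \<le> u * (?C x + e) + (1 - u) * (?C y + e) - 1 / \<alpha> * ?m"
      using a b u by (intro diff_right_mono add_mono mult_left_mono) auto
    also have "\<dots> = u * ?C x + (1 - u) * ?C y - \<kappa> / \<alpha> / 2 * u * (1 - u) * (norm (x - y))\<^sup>2 + e"
      by (simp add: distrib_left left_diff_distrib)
    finally show "?C ?z \<le> u * ?C x + (1 - u) * ?C y - \<kappa> / \<alpha> / 2 * u * (1 - u) * (norm (x - y))\<^sup>2 + e" .
  qed
qed

text \<open>
  Moving \<open>x\<close> by \<open>h\<close> moves \<open>t = z - x\<close> by \<open>- h\<close>, which explains the sign.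
\<close>

lemma Q_second_diff_ge:
  assumes \<theta>: "\<theta> \<in> borel_measurable borel" "\<forall>z. 0 \<le> \<theta> z" "\<mu> = density lborel (\<lambda>z. ennreal (\<theta> z))"
    and bound: "AE z in lborel. z \<in> ball x \<rho> \<longrightarrow> r \<le> \<theta> z"
  shows "r * (LINT t:ball 0 \<rho>|lborel. second_diff (excess \<phi>) (- h, \<delta>) (t, \<eta>))
    \<le> Q (x + h) (\<eta> + \<delta>) + Q (x - h) (\<eta> - \<delta>) - 2 * Q x \<eta>"
proof -
  let ?D = "\<lambda>t. second_diff (excess \<phi>) (- h, \<delta>) (t, \<eta>)"
  have D: "?D (z - x) = excess \<phi> (z - (x + h), \<eta> + \<delta>) + excess \<phi> (z - (x - h), \<eta> - \<delta>)
      - 2 * excess \<phi> (z - x, \<eta>)" for z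
    by (simp add: second_diff_def algebra_simps)
  have cont: "continuous_on UNIV (\<lambda>z. ?D (z - x))"
    by (rule continuous_on_compose2[OF continuous_on_second_diff_excess[OF convex_\<phi>]])
      (auto intro!: continuous_intros)
  have int: "integrable \<mu> (\<lambda>z. ?D (z - x))"
    unfolding D by (intro Bochner_Integration.integrable_add Bochner_Integration.integrable_diff
        integrable_mult_right integrable_excess)
  have "(LINT t:ball 0 \<rho>|lborel. ?D t) = (LINT t:ball 0 \<rho>|lborel. ?D ((t + x) - x))"
    by simp
  also have "\<dots> = (LINT z:(+) x ` ball 0 \<rho>|lborel. ?D (z - x))"
    by (rule set_integral_translate) (auto intro: borel_measurable_continuous_onI[OF cont])
  also have "(+) x ` ball 0 \<rho> = ball x \<rho>"
    using ball_translation[of x 0 \<rho>] by simp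
  finally have "r * (LINT t:ball 0 \<rho>|lborel. ?D t) = r * (LINT z:ball x \<rho>|lborel. ?D (z - x))"
    by simp
  also have "\<dots> \<le> (LINT z|\<mu>. ?D (z - x))"
    unfolding \<theta>(3)
  proof (rule density_integral_ge[OF \<theta>(1,2)])
    show "integrable (density lborel (\<lambda>z. ennreal (\<theta> z))) (\<lambda>z. ?D (z - x))"
      using int unfolding \<theta>(3) .
    show "set_integrable lborel (ball x \<rho>) (\<lambda>z. ?D (z - x))"
      by (intro set_integrable_continuous_bounded cont) auto
  qed (use bound cont second_diff_nonneg[OF convex_on_excess[OF convex_\<phi>]] in
      \<open>auto intro: borel_measurable_continuous_onI\<close>)
  also have "\<dots> = Q (x + h) (\<eta> + \<delta>) + Q (x - h) (\<eta> - \<delta>) - 2 * Q x \<eta>"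
    unfolding D Q_eq by (simp add: integrable_excess)
  finally show ?thesis .
qed

lemma continuous_Q_along_line: "continuous_on UNIV (\<lambda>s. Q (x + s *\<^sub>R h) (\<eta> + s * \<delta>))"
proof (rule convex_on_continuous[OF open_UNIV convex_onI])
  fix u s s' :: real assume u: "0 < u" "u < 1"
  let ?p = "\<lambda>z s. (z - (x + s *\<^sub>R h), \<eta> + s * \<delta>)"
  have "excess \<phi> (?p z ((1 - u) *\<^sub>R s + u *\<^sub>R s'))
    \<le> (1 - u) * excess \<phi> (?p z s) + u * excess \<phi> (?p z s')" for z
  proof -
    have "?p z ((1 - u) *\<^sub>R s + u *\<^sub>R s') = (1 - u) *\<^sub>R ?p z s + u *\<^sub>R ?p z s'"
      by (simp add: algebra_simps)
    then show ?thesis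
      using convex_onD[OF convex_on_excess[OF convex_\<phi>], of u "?p z s" "?p z s'"] u by simp
  qed
  then have "(LINT z|\<mu>. excess \<phi> (?p z ((1 - u) *\<^sub>R s + u *\<^sub>R s')))
    \<le> (LINT z|\<mu>. (1 - u) * excess \<phi> (?p z s) + u * excess \<phi> (?p z s'))"
    by (intro integral_mono integrable_excess Bochner_Integration.integrable_add integrable_mult_right)
  then show "Q (x + ((1 - u) *\<^sub>R s + u *\<^sub>R s') *\<^sub>R h) (\<eta> + ((1 - u) *\<^sub>R s + u *\<^sub>R s') * \<delta>)
    \<le> (1 - u) * Q (x + s *\<^sub>R h) (\<eta> + s * \<delta>) + u * Q (x + s' *\<^sub>R h) (\<eta> + s' * \<delta>)"
    by (simp add: Q_eq integrable_excess)
qed simp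

lemma partially_strongly_convex_Q:
  assumes \<theta>: "\<theta> \<in> borel_measurable borel" "\<forall>z. 0 \<le> \<theta> z" "\<mu> = density lborel (\<lambda>z. ennreal (\<theta> z))"
    and V: "convex V" and r: "0 < r"
    and bound: "\<And>x. x \<in> V \<Longrightarrow> AE z in lborel. z \<in> ball x \<rho> \<longrightarrow> r \<le> \<theta> z"
    and curv: "\<And>\<eta> h \<delta>. \<eta> \<le> \<eta>\<^sub>0 \<Longrightarrow> curvature_ge \<phi> \<rho> \<eta> h \<delta> (k * (norm h)\<^sup>2)"
  shows "partially_strongly_convex_on (r * k) V {..\<eta>\<^sub>0} Q"
  unfolding partially_strongly_convex_on_def
proof (intro conjI ballI V)
  show "convex {..\<eta>\<^sub>0}" by simp
  fix x1 x2 :: "real ^ 's" and y1 y2 u :: real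
  assume x: "x1 \<in> V" "x2 \<in> V" and y: "y1 \<in> {..\<eta>\<^sub>0}" "y2 \<in> {..\<eta>\<^sub>0}" and u: "u \<in> {0<..<1}"
  define h \<delta> where "h = x1 - x2" and "\<delta> = y1 - y2"
  define f where "f = (\<lambda>s. Q (x2 + s *\<^sub>R h) (y2 + s * \<delta>))"
  have "f u \<le> (1 - u) * f 0 + u * f 1 - r * (k * (norm h)\<^sup>2) / 2 * u * (1 - u)"
  proof (rule strongly_convex_if_second_diff_ge)
    show "continuous_on {0..1} f"
      unfolding f_def by (rule continuous_on_subset[OF continuous_Q_along_line]) simp
    show "\<exists>e0>0. \<forall>e. 0 < e \<longrightarrow> e < e0 \<longrightarrow> r * (k * (norm h)\<^sup>2) * e\<^sup>2 \<le> second_diff f e s"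
      if s: "0 < s" "s < 1" for s
    proof -
      define x \<eta> where "x = x2 + s *\<^sub>R h" and "\<eta> = y2 + s * \<delta>"
      have "x = (1 - s) *\<^sub>R x2 + s *\<^sub>R x1" by (simp add: x_def h_def algebra_simps)
      then have xV: "x \<in> V" using V x s by (simp add: convexD)
      have "\<eta> = (1 - s) * y2 + s * y1" by (simp add: \<eta>_def \<delta>_def algebra_simps)
      also have "\<dots> \<le> (1 - s) * \<eta>\<^sub>0 + s * \<eta>\<^sub>0"
        using y s by (intro add_mono mult_left_mono) auto
      finally have "\<eta> \<le> \<eta>\<^sub>0" by (simp add: algebra_simps)
      then have "curvature_ge \<phi> \<rho> \<eta> (- h) \<delta> (k * (norm h)\<^sup>2)"
        using curv[of \<eta> "- h" \<delta>] by simp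
      then obtain e0 where e0: "0 < e0" "\<And>e. 0 < e \<Longrightarrow> e < e0 \<Longrightarrow> k * (norm h)\<^sup>2 * e\<^sup>2
          \<le> (LINT t:ball 0 \<rho>|lborel. second_diff (excess \<phi>) (e *\<^sub>R - h, e * \<delta>) (t, \<eta>))"
        unfolding curvature_ge_def eventually_at_right_field by blast
      have "r * (k * (norm h)\<^sup>2) * e\<^sup>2 \<le> second_diff f e s" if e: "0 < e" "e < e0" for e
      proof -
        have "r * (k * (norm h)\<^sup>2 * e\<^sup>2)
          \<le> r * (LINT t:ball 0 \<rho>|lborel. second_diff (excess \<phi>) (- (e *\<^sub>R h), e * \<delta>) (t, \<eta>))"
          using e0(2)[OF e] r by (intro mult_left_mono) auto
        also have "\<dots> \<le> Q (x + e *\<^sub>R h) (\<eta> + e * \<delta>) + Q (x - e *\<^sub>R h) (\<eta> - e * \<delta>) - 2 * Q x \<eta>"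
          by (rule Q_second_diff_ge[OF \<theta> bound[OF xV]])
        also have "\<dots> = second_diff f e s"
          by (simp add: second_diff_def f_def x_def \<eta>_def algebra_simps)
        finally show ?thesis by (simp add: mult.assoc)
      qed
      then show ?thesis using e0(1) by blast
    qed
  qed (use u in auto)
  moreover have "u *\<^sub>R x1 + (1 - u) *\<^sub>R x2 = x2 + u *\<^sub>R h" "u *\<^sub>R y1 + (1 - u) *\<^sub>R y2 = y2 + u * \<delta>"
    by (simp_all add: h_def \<delta>_def algebra_simps)
  ultimately show "Q (u *\<^sub>R x1 + (1 - u) *\<^sub>R x2) (u *\<^sub>R y1 + (1 - u) *\<^sub>R y2)
      \<le> u * Q x1 y1 + (1 - u) * Q x2 y2 - r * k / 2 * u * (1 - u) * (norm (x1 - x2))\<^sup>2"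
    by (simp add: f_def h_def \<delta>_def algebra_simps)
qed

end

theorem theorem3:
  fixes W :: "real ^ 'm ^ 's" and q :: "real ^ 'm"
    and \<mu> :: "(real ^ 's) measure" and \<theta> :: "real ^ 's \<Rightarrow> real"
    and V :: "(real ^ 's) set" and \<alpha> r \<rho> \<eta>\<^sub>0 :: real
  assumes \<mu>_borel: "sets \<mu> = sets borel" and \<mu>_prob: "prob_space \<mu>"
    and \<alpha>: "0 < \<alpha>" "\<alpha> < 1"
    and A1: "\<forall>t. \<exists>y. (\<forall>j. 0 \<le> y $ j) \<and> W *v y = t"
    and A2: "\<exists>v. \<forall>j. (transpose W *v v) $ j < q $ j"
    and A3: "integrable \<mu> (\<lambda>z. norm z)"
    and A4_density: "\<theta> \<in> borel_measurable borel" "\<forall>z. 0 \<le> \<theta> z"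
      "\<mu> = density lborel (\<lambda>z. ennreal (\<theta> z))"
    and A4_V: "convex V" "open V"
    and A4_bound: "0 < r" "0 < \<rho>"
      "AE z in lborel. z \<in> {v + b | v b. v \<in> V \<and> b \<in> ball 0 \<rho>} \<longrightarrow> r \<le> \<theta> z"
    and A5: "0 < \<eta>\<^sub>0" "\<forall>d\<in>plus_vertices W q. norm (min_norm_ray_point W q d \<eta>\<^sub>0) < \<rho>"
    and A6: "\<forall>j. 0 < q $ j"
    and VaR_bound: "(SUP x\<in>V. ereal (Q_VaR W q \<mu> \<alpha> x)) \<le> ereal \<eta>\<^sub>0"
  shows "(\<exists>\<kappa>>0. partially_strongly_convex_on \<kappa> V {..\<eta>\<^sub>0} (Q_EE W q \<mu>)) \<and>
    (\<forall>\<kappa>>0. partially_strongly_convex_on \<kappa> V {..\<eta>\<^sub>0} (Q_EE W q \<mu>) \<longrightarrow>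
      strongly_convex_on (\<kappa> / \<alpha>) V (Q_CVaR W q \<mu> \<alpha>))"
proof -
  interpret prob_space \<mu> by (rule \<mu>_prob)
  interpret recourse_risk W q \<mu>
    by unfold_locales (use A1 A6 \<mu>_borel A3 in auto)
  obtain c L where "coercive_convex \<phi> c L" using coercive_convex_recourse_value by blast
  then interpret coercive_convex \<phi> c L .
  have "finite (plus_vertices W q)"
    using finite_subset[OF _ finite_dual_vertices] by (auto simp: plus_vertices_def)
  moreover have "\<exists>b R. 0 < R \<and> d \<bullet> b = \<eta>\<^sub>0 \<and> ball b R \<subseteq> ball 0 \<rho> \<inter> {t. \<phi> t = d \<bullet> t}"
    if "d \<in> plus_vertices W q" for d
    using window_on_level_set[OF that A5(1)] A5(2) that by blast
  ultimately have "\<exists>k>0. \<forall>\<eta>\<le>\<eta>\<^sub>0. \<forall>h \<delta>. curvature_ge \<phi> \<rho> \<eta> h \<delta> (k * (norm h)\<^sup>2)"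
    using homogeneous max_attained_at_plus_vertex A5(1) A4_bound(2)
    by (intro uniform_curvature[of "plus_vertices W q"]) auto
  then obtain k where k: "0 < k" "\<And>\<eta> h \<delta>. \<eta> \<le> \<eta>\<^sub>0 \<Longrightarrow> curvature_ge \<phi> \<rho> \<eta> h \<delta> (k * (norm h)\<^sup>2)"
    by blast
  have "AE z in lborel. z \<in> ball x \<rho> \<longrightarrow> r \<le> \<theta> z" if "x \<in> V" for x
    using A4_bound(3)
  proof eventually_elim
    case (elim z)
    show ?case
    proof
      assume "z \<in> ball x \<rho>"
      then have "z = x + (z - x)" "z - x \<in> ball 0 \<rho>" by (auto simp: dist_norm norm_minus_commute)
      with that elim show "r \<le> \<theta> z" by blast
    qed
  qed
  then have "partially_strongly_convex_on (r * k) V {..\<eta>\<^sub>0} Q"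
    by (intro partially_strongly_convex_Q[OF A4_density A4_V(1) A4_bound(1) _ k(2)])
  then have "\<exists>\<kappa>>0. partially_strongly_convex_on \<kappa> V {..\<eta>\<^sub>0} Q"
    using k(1) A4_bound(1) by (intro exI[of _ "r * k"]) simp
  moreover have "Q_VaR W q \<mu> \<alpha> x \<le> \<eta>\<^sub>0" if "x \<in> V" for x
    using VaR_bound that by (auto simp: SUP_le_iff)
  ultimately show ?thesis
    using strongly_convex_CVaR[OF \<alpha>] by blast
qed

end
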